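(* Let $N\ge 1$ and let $\{\psi_j\}_{j=1}^N\subset H^1(\mathbb{S}^2)$ be a family of real-valued scalar functions that is orthonormal in $L_2(\mathbb{S}^2)$ and such that each function has zero average: $\int_{\mathbb{S}^2}\psi_j(s)\,dS=0$ for $j=1,\dots,N$. Then the function $\rho(s):=\sum_{j=1}^N\psi_j(s)^2$ satisfies the inequality $$ \int_{\mathbb{S}^2}\rho(s)^2\,dS\le\frac{9}{4\pi}\sum_{j=1}^N\|\nabla\psi_j\|^2 . $$
   Context: $\mathbb{S}^2$ is the unit two-dimensional sphere with its standard round metric and surface measure $dS$ (total area $4\pi$). $\nabla$ is the (Riemannian) gradient on $\mathbb{S}^2$, and $\|\cdot\|$ is the $L_2$ norm over $\mathbb{S}^2$, so $\|\nabla\psi\|^2=\int_{\mathbb{S}^2}|\nabla\psi(s)|^2\,dS$. $H^1(\mathbb{S}^2)$ is the standard Sobolev space. *)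

theory Defs
  imports "HOL-Analysis.Analysis"
begin

text \<open>
  Surface measure on the unit sphere of \<open>\<real>\<^sup>3\<close>, on the Borel sets of the sphere.  It is defined by
  integration in polar coordinates: the surface area of \<open>A\<close> is three times the volume of the cone
  \<open>{t x | 0 < t < 1, x \<in> A}\<close>.  On nonzero vectors, \<open>sgn x = x / |x|\<close>.
\<close>

definition sphere2 :: "(real^3) measure" where
  "sphere2 = scale_measure 3
     (distr (restrict_space lborel (ball 0 1 - {0})) (restrict_space borel (sphere 0 1)) sgn)"

lemma space_sphere2 [simp]: "space sphere2 = sphere 0 1"
  by (simp add: sphere2_def space_scale_measure space_restrict_space)

lemma sets_sphere2 [measurable_cong]: "sets sphere2 = sets (restrict_space borel (sphere 0 1))"
  by (simp add: sphere2_def)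

lemma measurable_sgn_sphere:
  "sgn \<in> restrict_space lborel (ball 0 1 - {0::real^3}) \<rightarrow>\<^sub>M restrict_space borel (sphere 0 1)"
proof (rule measurable_restrict_space2)
  show "sgn \<in> space (restrict_space lborel (ball 0 1 - {0::real^3})) \<rightarrow> sphere 0 1"
    by (auto simp: space_restrict_space norm_sgn)
  show "sgn \<in> borel_measurable (restrict_space lborel (ball 0 1 - {0::real^3}))"
    unfolding sgn_div_norm by (intro measurable_restrict_space1) measurable
qed

lemma emeasure_sphere2:
  assumes "A \<in> sets sphere2"
  shows "emeasure sphere2 A = 3 * emeasure lborel {x \<in> ball 0 1 - {0}. sgn x \<in> A}"
proof -
  have A: "A \<in> sets (restrict_space borel (sphere 0 1))"
    using assms by (simp add: sets_sphere2)
  have eq: "sgn -` A \<inter> space (restrict_space lborel (ball 0 1 - {0::real^3}))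
      = {x \<in> ball 0 1 - {0}. sgn x \<in> A}"
    by (auto simp: space_restrict_space)
  have "emeasure sphere2 A
      = 3 * emeasure (restrict_space lborel (ball 0 1 - {0})) {x \<in> ball 0 1 - {0}. sgn x \<in> A}"
    using A by (simp only: sphere2_def emeasure_scale_measure emeasure_distr[OF measurable_sgn_sphere] eq)
  also have "emeasure (restrict_space lborel (ball 0 1 - {0})) {x \<in> ball 0 1 - {0}. sgn x \<in> A}
      = emeasure lborel {x \<in> ball 0 1 - {0}. sgn x \<in> A}"
    by (rule emeasure_restrict_space) auto
  finally show ?thesis .
qed

lemma emeasure_sphere2_total: "emeasure sphere2 (sphere 0 1) = 4 * pi"
proof -
  have "sphere 0 1 \<in> sets sphere2"
    using sets.top[of sphere2] by simp
  then have "emeasure sphere2 (sphere 0 1)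
      = 3 * emeasure lborel {x \<in> ball 0 1 - {0::real^3}. sgn x \<in> sphere 0 1}"
    by (rule emeasure_sphere2)
  also have "{x \<in> ball 0 1 - {0::real^3}. sgn x \<in> sphere 0 1} = ball 0 1 - {0}"
    by (auto simp: norm_sgn)
  also have "emeasure lborel (ball 0 1 - {0::real^3}) = emeasure lborel (ball 0 1 :: (real^3) set)"
    by (intro emeasure_Diff_null_set) auto
  also have "\<dots> = ennreal (4 / 3 * pi)"
    using unit_ball_vol_3 by (simp add: emeasure_ball)
  also have "3 * ennreal (4 / 3 * pi) = ennreal (4 * pi)"
    by (simp flip: ennreal_numeral ennreal_mult)
  finally show ?thesis .
qed

lemma emeasure_sphere2_rotation:
  fixes T :: "real^3 \<Rightarrow> real^3"
  assumes T: "orthogonal_transformation T" and A: "A \<in> sets sphere2" "T ` A \<in> sets sphere2"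
  shows "emeasure sphere2 (T ` A) = emeasure sphere2 A"
proof -
  let ?C = "\<lambda>A. {x \<in> ball 0 1 - {0::real^3}. sgn x \<in> A}"
  have lin: "linear T" and nT: "\<And>x. norm (T x) = norm x" and inj: "inj T" and surj: "surj T"
    using T by (auto simp: orthogonal_transformation_linear orthogonal_transformation_norm
        orthogonal_transformation_inj orthogonal_transformation_surj)
  have sgnT: "sgn (T x) = T (sgn x)" for x
    by (simp add: sgn_div_norm nT linear_scale[OF lin])
  have T0: "T x = 0 \<longleftrightarrow> x = 0" for x
    by (metis nT norm_eq_zero)
  have CT: "?C (T ` A) = T ` ?C A"
  proof (intro set_eqI iffI)
    fix y assume y: "y \<in> ?C (T ` A)"
    obtain x where x: "y = T x" using surj by auto
    show "y \<in> T ` ?C A"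
      using y inj by (auto simp: x nT T0 sgnT inj_image_mem_iff)
  qed (auto simp: nT T0 sgnT)
  have meas: "?C B \<in> sets borel" if "B \<in> sets sphere2" for B
  proof -
    have "sgn -` B \<inter> space (restrict_space lborel (ball 0 1 - {0::real^3}))
        \<in> sets (restrict_space lborel (ball 0 1 - {0}))"
      using that by (intro measurable_sets[OF measurable_sgn_sphere]) (simp add: sets_sphere2)
    also have "sgn -` B \<inter> space (restrict_space lborel (ball 0 1 - {0::real^3})) = ?C B"
      by (auto simp: space_restrict_space)
    finally show ?thesis
      by (subst (asm) sets_restrict_space_iff) auto
  qed
  have bdd: "bounded (?C A)"
    by (rule bounded_subset[of "ball 0 1"]) auto
  have lm: "?C A \<in> lmeasurable"
    using bdd meas[OF A(1)] by (intro bounded_set_imp_lmeasurable) auto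
  have lmT: "T ` ?C A \<in> lmeasurable"
    by (rule measurable_orthogonal_image[OF T lm])
  have "measure lebesgue (T ` ?C A) = measure lebesgue (?C A)"
    by (rule measure_orthogonal_image[OF T lm])
  then have "emeasure lebesgue (T ` ?C A) = emeasure lebesgue (?C A)"
    unfolding emeasure_eq_measure2[OF lm] emeasure_eq_measure2[OF lmT] by (rule arg_cong)
  then have "emeasure lborel (?C (T ` A)) = emeasure lborel (?C A)"
    using meas[OF A(1)] meas[OF A(2)] unfolding CT[symmetric] by simp
  then show ?thesis
    unfolding emeasure_sphere2[OF A(1)] emeasure_sphere2[OF A(2)] by (rule arg_cong)
qed

definition sphere_L2 :: "(real^3 \<Rightarrow> 'b::{banach,second_countable_topology}) set" where
  "sphere_L2 = {f. f \<in> borel_measurable sphere2 \<and> integrable sphere2 (\<lambda>s. (norm (f s))\<^sup>2)}"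

definition sphere_L2_norm :: "(real^3 \<Rightarrow> 'b::{banach,second_countable_topology}) \<Rightarrow> real" where
  "sphere_L2_norm f = sqrt (LINT s|sphere2. (norm (f s))\<^sup>2)"

primrec Ck :: "nat \<Rightarrow> (real^3 \<Rightarrow> real^3) \<Rightarrow> bool" where
  "Ck 0 F \<longleftrightarrow> continuous_on UNIV F"
| "Ck (Suc k) F \<longleftrightarrow> F differentiable_on UNIV \<and> (\<forall>v. Ck k (\<lambda>x. frechet_derivative F (at x) v))"

text \<open>
  Every smooth tangential vector field on the sphere extends to a smooth map on \<open>\<real>\<^sup>3\<close>, so the fields
  below represent exactly the smooth vector fields of the sphere.
\<close>

definition smooth_tangent_field :: "(real^3 \<Rightarrow> real^3) \<Rightarrow> bool" where
  "smooth_tangent_field F \<longleftrightarrow> (\<forall>k. Ck k F) \<and> (\<forall>s\<in>sphere 0 1. F s \<bullet> s = 0)"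

text \<open>
  Riemannian divergence of a tangential field at a point \<open>s\<close> of the sphere: the trace of the
  derivative over the tangent plane, that is, the full trace minus the contribution of the unit
  normal \<open>s\<close>.  It depends only on the values of \<open>F\<close> on the sphere.
\<close>

definition sphere_div :: "(real^3 \<Rightarrow> real^3) \<Rightarrow> real^3 \<Rightarrow> real" where
  "sphere_div F s = (\<Sum>b\<in>Basis. frechet_derivative F (at s) b \<bullet> b) - frechet_derivative F (at s) s \<bullet> s"

definition has_weak_sphere_grad :: "(real^3 \<Rightarrow> real) \<Rightarrow> (real^3 \<Rightarrow> real^3) \<Rightarrow> bool" where
  "has_weak_sphere_grad u g \<longleftrightarrow>
     g \<in> sphere_L2 \<and> (AE s in sphere2. g s \<bullet> s = 0) \<and>
     (\<forall>F. smooth_tangent_field F \<longrightarrow>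
        (LINT s|sphere2. g s \<bullet> F s) = - (LINT s|sphere2. u s * sphere_div F s))"

definition sphere_H1 :: "(real^3 \<Rightarrow> real) set" where
  "sphere_H1 = {u \<in> sphere_L2. \<exists>g. has_weak_sphere_grad u g}"

text \<open>
  The weak gradient is unique up to null sets, so integrals of it do not depend on the choice.
\<close>

definition sphere_grad :: "(real^3 \<Rightarrow> real) \<Rightarrow> real^3 \<Rightarrow> real^3" where
  "sphere_grad u = (SOME g. has_weak_sphere_grad u g)"

end

theory Submission
  imports Defs "HOL-Library.Discrete_Functions"
begin

text \<open>
The proof is Rumin's, run on the spherical harmonics. Order an orthonormal family of harmonics
\<open>e\<^sub>0, e\<^sub>1, \<dots>\<close> by degree, so that those of degree at most \<open>n\<close> are the first \<open>(n + 1)\<^sup>2\<close>, and let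
\<open>\<lambda>\<^sub>n = n (n + 1)\<close> be the eigenvalue of degree \<open>n\<close>. Cut every \<open>\<psi>\<^sub>j\<close> at degree \<open>n\<close> into a low part and a
residual.

The low parts are small pointwise. At a point \<open>s\<close> the values of the low parts are inner products of
the \<open>\<psi>\<^sub>j\<close> with one fixed function, so Bessel's inequality for the orthonormal family \<open>\<psi>\<close>
bounds the sum of their squares by the squared norm of that function. This norm is
\<open>\<Sum>\<^bsub>1 \<le> k < (n + 1)\<^sup>2\<^esub> e\<^sub>k(s)\<^sup>2\<close>, the constants being absent because the averages vanish, and
rotation invariance makes it a constant, at most \<open>((n + 1)\<^sup>2 - 1) / 4\<pi>\<close>. As
\<open>n (n + 2) \<le> (3/2) n (n + 1)\<close>, this is at most \<open>c \<lambda>\<^sub>n\<close> with \<open>c = 3 / 8\<pi>\<close>. By the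
triangle inequality in \<open>\<real>\<^sup>N\<close> the residuals at \<open>s\<close> have squared length at least
\<open>(\<surd>\<rho>(s) - \<surd>(c \<lambda>\<^sub>n))\<^sub>+\<^sup>2\<close> (lemma \<open>high_frequency_ge\<close>).

The residuals are controlled in the mean. Summation by parts turns
\<open>\<Sum>\<^sub>n (\<lambda>\<^bsub>n+1\<^esub> - \<lambda>\<^sub>n) \<parallel>residual\<^sub>n\<parallel>\<^sup>2\<close> into the sum over \<open>k\<close> of \<open>\<langle>\<psi>\<^sub>j, e\<^sub>k\<rangle>\<^sup>2\<close> times the
eigenvalue of \<open>e\<^sub>k\<close>, which is at most \<open>\<parallel>\<nabla>\<psi>\<^sub>j\<parallel>\<^sup>2\<close> (lemma \<open>tail_sum_le\<close>). Summing the pointwise lower bounds with the weights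
\<open>\<lambda>\<^bsub>n+1\<^esub> - \<lambda>\<^sub>n\<close> gives at least
\<open>\<integral> (\<surd>\<rho> - \<surd>(c E))\<^sub>+\<^sup>2 dE = \<rho>\<^sup>2 / 6c\<close>, whence the constant \<open>6 c = 9 / 4\<pi>\<close>.

The harmonics are built without special functions. Let \<open>V\<^sub>n\<close> be the restrictions to the sphere of the
polynomials of degree less than \<open>n\<close>. Since \<open>z\<^sup>2 = 1 - x\<^sup>2 - y\<^sup>2\<close> there, \<open>V\<^sub>n\<close> is spanned by the \<open>n\<^sup>2\<close>
monomials of degree less than \<open>n\<close> that are at most linear in \<open>z\<close>; the \<open>e\<^sub>k\<close> arise from them by the
Gram-Schmidt process. The Laplace operator, taken as the sum of the squares of the three generators of
rotations, is symmetric and acts on \<open>V\<^bsub>n+1\<^esub>\<close> as \<open>-\<lambda>\<^sub>n\<close> modulo \<open>V\<^sub>n\<close> (lemma \<open>lap_leading\<close>). An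
element of \<open>V\<^bsub>n+1\<^esub>\<close> orthogonal to \<open>V\<^sub>n\<close> is therefore an eigenfunction (lemma \<open>lap_harmonic\<close>). The
weak gradient enters only through the fields \<open>f(x) (w \<times> x)\<close> with \<open>f\<close> a polynomial, whose divergence is
the rotational derivative of \<open>f\<close>. Completeness of the harmonics is the density of polynomials in
\<open>L\<^sup>2\<close>, by the Stone-Weierstrass theorem and inner regularity of the surface measure.
\<close>

section \<open>Polynomials of bounded degree and generators of rotations\<close>

text \<open>
Polynomial functions of degree less than \<open>n\<close>, so that \<open>n = 0\<close> leaves only the zero function. With
this indexing a lower-order remainder is always an element of the preceding space, also in degree 0,
and the dimension of the restrictions to the sphere is bounded by \<open>n\<^sup>2\<close>.
\<close>

inductive deg_less :: "nat \<Rightarrow> (real^3 \<Rightarrow> real) \<Rightarrow> bool" where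
  zero: "deg_less n (\<lambda>x. 0)"
| const: "deg_less (Suc n) (\<lambda>x. c)"
| linear: "deg_less n f \<Longrightarrow> deg_less (Suc n) (\<lambda>x. (v \<bullet> x) * f x)"
| add: "deg_less n f \<Longrightarrow> deg_less n g \<Longrightarrow> deg_less n (\<lambda>x. f x + g x)"

lemma deg_less_0: "deg_less n f \<Longrightarrow> n = 0 \<Longrightarrow> f = (\<lambda>x. 0)"
  by (induction rule: deg_less.induct) auto

lemma deg_less_Suc: "deg_less n f \<Longrightarrow> deg_less (Suc n) f"
  by (induction rule: deg_less.induct) (auto intro: deg_less.intros)

lemma deg_less_mono: "deg_less m f \<Longrightarrow> m \<le> n \<Longrightarrow> deg_less n f"
  by (induction n rule: nat_induct) (auto simp: le_Suc_eq intro: deg_less_Suc)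

lemma deg_less_scale: "deg_less n f \<Longrightarrow> deg_less n (\<lambda>x. c * f x)"
proof (induction rule: deg_less.induct)
  case (linear n f v)
  then show ?case using deg_less.linear[OF linear.IH, of v] by (simp add: mult.left_commute)
next
  case (add n f g)
  then show ?case using deg_less.add[OF add.IH] by (simp add: distrib_left)
qed (auto intro: deg_less.intros)

lemma deg_less_diff: "deg_less n f \<Longrightarrow> deg_less n g \<Longrightarrow> deg_less n (\<lambda>x. f x - g x)"
  using deg_less.add[of n f "\<lambda>x. (-1) * g x"] deg_less_scale[of n g "-1"] by simp

lemma deg_less_sum: "(\<And>i. i \<in> I \<Longrightarrow> deg_less n (f i)) \<Longrightarrow> deg_less n (\<lambda>x. \<Sum>i\<in>I. f i x)"
  by (induction I rule: infinite_finite_induct) (auto intro: deg_less.intros)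

lemma deg_less_mult: "deg_less m f \<Longrightarrow> deg_less n g \<Longrightarrow> deg_less (m + n) (\<lambda>x. f x * g x)"
proof (induction rule: deg_less.induct)
  case (const m c)
  then have "deg_less n (\<lambda>x. c * g x)" by (rule deg_less_scale)
  then show ?case by (rule deg_less_mono) simp
next
  case (linear m f v)
  then have "deg_less (Suc (m + n)) (\<lambda>x. (v \<bullet> x) * (f x * g x))" by (intro deg_less.linear)
  then show ?case by (simp add: mult.assoc)
next
  case (add m f g')
  then show ?case using deg_less.add[OF add.IH] by (simp add: distrib_right)
qed (auto intro: deg_less.intros)

lemma deg_less_inner: "deg_less (Suc (Suc n)) (\<lambda>x. v \<bullet> x)"
  using deg_less.linear[OF deg_less.const, of n v 1] by simp

lemma deg_less_power: "deg_less (Suc k) (\<lambda>x. (v \<bullet> x) ^ k)"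
  by (induction k) (auto intro: deg_less.intros)

lemma deg_less_linear_power: "deg_less n f \<Longrightarrow> deg_less (k + n) (\<lambda>x. (v \<bullet> x) ^ k * f x)"
proof (induction k)
  case (Suc k)
  then show ?case using deg_less.linear[OF Suc.IH, of v] by (simp add: mult.assoc)
qed simp

text \<open>
The adjoint moves the linear map from the variable to the vectors that define the linear factors.
\<close>

lemma deg_less_compose_linear:
  assumes "linear T" shows "deg_less n f \<Longrightarrow> deg_less n (\<lambda>x. f (T x))"
proof (induction rule: deg_less.induct)
  case (linear n f v)
  then have "deg_less (Suc n) (\<lambda>x. (adjoint T v \<bullet> x) * f (T x))" by (intro deg_less.linear)
  moreover have "adjoint T v \<bullet> x = v \<bullet> T x" for x
    using adjoint_works[OF assms, of x v] by (simp add: inner_commute)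
  ultimately show ?case by simp
qed (auto intro: deg_less.intros)

lemma deg_less_real_polynomial_function:
  "deg_less n f \<Longrightarrow> real_polynomial_function f"
  by (induction rule: deg_less.induct)
    (auto intro!: real_polynomial_function.intros(2-4) real_polynomial_function.intros(1)[of "(\<bullet>) v" for v]
      simp: bounded_linear_inner_right)

lemma real_polynomial_function_deg_less:
  fixes f :: "real^3 \<Rightarrow> real"
  shows "real_polynomial_function f \<Longrightarrow> \<exists>n. deg_less n f"
proof (induction rule: real_polynomial_function.induct)
  case (linear f)
  have "f = (\<lambda>x. adjoint f 1 \<bullet> x)"
    using adjoint_works[OF bounded_linear.linear[OF linear]] by (auto simp: inner_commute)
  then show ?case using deg_less_inner by metis
next
  case (add f g)
  then obtain m n where "deg_less m f" "deg_less n g" by auto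
  then show ?case by (intro exI[of _ "max m n"] deg_less.add) (auto intro: deg_less_mono)
qed (auto intro: deg_less.intros deg_less_mult)

lemma deg_less_has_derivative:
  "deg_less n f \<Longrightarrow> (f has_derivative frechet_derivative f (at x)) (at x)"
  using differentiable_at_real_polynomial_function[OF deg_less_real_polynomial_function]
  by (simp flip: frechet_derivative_works)

lemma deg_less_continuous_on: "deg_less n f \<Longrightarrow> continuous_on S f"
  using deg_less_real_polynomial_function by (auto intro: continuous_on_polymonial_function simp: real_polynomial_function_eq)

lemma frechet_linear_mult:
  assumes "deg_less n f"
  shows "frechet_derivative (\<lambda>x. (v \<bullet> x) * f x) (at x) h
    = (v \<bullet> h) * f x + (v \<bullet> x) * frechet_derivative f (at x) h"
proof -
  note [derivative_intros] = deg_less_has_derivative[OF assms]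
  have "((\<lambda>x. (v \<bullet> x) * f x) has_derivative
      (\<lambda>h. (v \<bullet> h) * f x + (v \<bullet> x) * frechet_derivative f (at x) h)) (at x)"
    by (auto intro!: derivative_eq_intros)
  from frechet_derivative_at[OF this] show ?thesis by metis
qed

lemma frechet_add:
  assumes "deg_less m f" "deg_less n g"
  shows "frechet_derivative (\<lambda>x. f x + g x) (at x) h
    = frechet_derivative f (at x) h + frechet_derivative g (at x) h"
  using frechet_derivative_at[OF has_derivative_add[OF assms[THEN deg_less_has_derivative, of x]]]
  by metis

lemma frechet_mult:
  assumes "deg_less m f" "deg_less n g"
  shows "frechet_derivative (\<lambda>x. f x * g x) (at x) h
    = f x * frechet_derivative g (at x) h + frechet_derivative f (at x) h * g x"
  using frechet_derivative_at[OF has_derivative_mult[OF assms[THEN deg_less_has_derivative, of x]]]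
  by metis

lemma deg_less_frechet:
  "deg_less n f \<Longrightarrow> deg_less (n - 1) (\<lambda>x. frechet_derivative f (at x) v)"
proof (induction rule: deg_less.induct)
  case (linear n f u)
  show ?case
  proof (cases n)
    case 0
    then show ?thesis using deg_less_0[OF linear.hyps] by (auto intro: deg_less.intros)
  next
    case (Suc m)
    have "deg_less n (\<lambda>x. (u \<bullet> v) * f x + (u \<bullet> x) * frechet_derivative f (at x) v)"
      using linear Suc by (intro deg_less.add deg_less_scale) (auto intro: deg_less.intros)
    then show ?thesis by (simp add: frechet_linear_mult[OF linear.hyps])
  qed
next
  case (add n f g)
  then show ?case by (auto simp: frechet_add intro: deg_less.intros)
qed (auto intro: deg_less.intros)

text \<open>
The derivative along the rotation field \<open>x \<mapsto> w \<times> x\<close>: the angular momentum operator about the axis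
\<open>w\<close>. The field is tangential, so on the sphere the result depends only on the values there.
\<close>

definition rot :: "real^3 \<Rightarrow> (real^3 \<Rightarrow> real) \<Rightarrow> real^3 \<Rightarrow> real" where
  "rot w f x = frechet_derivative f (at x) (cross3 w x)"

lemma cross_triple': "v \<bullet> cross3 w x = cross3 v w \<bullet> x"
  by (metis cross_triple inner_commute)

lemma rot_linear_mult:
  assumes "deg_less n f"
  shows "rot w (\<lambda>x. (v \<bullet> x) * f x) = (\<lambda>x. (cross3 v w \<bullet> x) * f x + (v \<bullet> x) * rot w f x)"
  by (rule ext) (simp add: rot_def frechet_linear_mult[OF assms] cross_triple')

lemma rot_add:
  assumes "deg_less m f" "deg_less n g"
  shows "rot w (\<lambda>x. f x + g x) = (\<lambda>x. rot w f x + rot w g x)"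
  by (rule ext) (simp add: rot_def frechet_add[OF assms])

lemma rot_mult:
  assumes "deg_less m f" "deg_less n g"
  shows "rot w (\<lambda>x. f x * g x) = (\<lambda>x. f x * rot w g x + rot w f x * g x)"
  by (rule ext) (simp add: rot_def frechet_mult[OF assms])

lemma rot_const [simp]: "rot w (\<lambda>x. c) = (\<lambda>x. 0)"
  by (rule ext) (simp add: rot_def)

lemma deg_less_rot: "deg_less n f \<Longrightarrow> deg_less n (rot w f)"
proof (induction rule: deg_less.induct)
  case (linear n f v)
  then show ?case by (auto simp: rot_linear_mult intro: deg_less.intros)
next
  case (add n f g)
  then show ?case by (auto simp: rot_add intro: deg_less.intros)
qed (auto intro: deg_less.intros)

lemma rot_scale: "deg_less n f \<Longrightarrow> rot w (\<lambda>x. c * f x) = (\<lambda>x. c * rot w f x)"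
  using rot_mult[OF deg_less.const[of 0 c], of n f w] by simp

lemma rot_sum:
  "(\<And>i. i \<in> I \<Longrightarrow> deg_less n (f i)) \<Longrightarrow> rot w (\<lambda>x. \<Sum>i\<in>I. f i x) = (\<lambda>x. \<Sum>i\<in>I. rot w (f i) x)"
proof (induction I rule: infinite_finite_induct)
  case (insert i I)
  then show ?case using rot_add[of n "f i" n "\<lambda>x. \<Sum>i\<in>I. f i x" w] deg_less_sum[of I n f] by simp
qed auto

text \<open>
The Laplace-Beltrami operator of the sphere, written as the Casimir operator of the rotation group.
\<close>

definition lap :: "(real^3 \<Rightarrow> real) \<Rightarrow> real^3 \<Rightarrow> real" where
  "lap f x = (\<Sum>w\<in>Basis. rot w (rot w f) x)"

lemma deg_less_lap: "deg_less n f \<Longrightarrow> deg_less n (lap f)"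
  unfolding lap_def[abs_def] by (intro deg_less_sum deg_less_rot)

text \<open>
Euler's identity for homogeneous functions, read modulo terms of lower degree.
\<close>

lemma euler_leading:
  "deg_less n f \<Longrightarrow> \<exists>r. deg_less (n - 1) r \<and>
     (\<forall>x. frechet_derivative f (at x) x = (real n - 1) * f x + r x)"
proof (induction rule: deg_less.induct)
  case (zero n)
  then show ?case by (intro exI[of _ "\<lambda>x. 0"]) (auto intro: deg_less.intros)
next
  case (const n c)
  have "deg_less n (\<lambda>x. - real n * c)" by (cases n) (auto intro: deg_less.intros)
  then show ?case by (intro exI[of _ "\<lambda>x. - real n * c"]) auto
next
  case (linear n f v)
  then obtain r where r: "deg_less (n - 1) r"
    "\<And>x. frechet_derivative f (at x) x = (real n - 1) * f x + r x" by auto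
  show ?case
  proof (cases n)
    case 0
    then show ?thesis using deg_less_0[OF linear.hyps]
      by (intro exI[of _ "\<lambda>x. 0"]) (auto intro: deg_less.intros)
  next
    case (Suc m)
    have "deg_less n (\<lambda>x. (v \<bullet> x) * r x)" using r(1) Suc by (auto intro: deg_less.intros)
    moreover have "frechet_derivative (\<lambda>x. (v \<bullet> x) * f x) (at x) x
        = (real (Suc n) - 1) * ((v \<bullet> x) * f x) + (v \<bullet> x) * r x" for x
      unfolding frechet_linear_mult[OF linear.hyps] r(2) by (simp add: algebra_simps)
    ultimately show ?thesis by (intro exI[of _ "\<lambda>x. (v \<bullet> x) * r x"]) auto
  qed
next
  case (add n f g)
  then obtain r q where "deg_less (n - 1) r" "deg_less (n - 1) q"
    "\<And>x. frechet_derivative f (at x) x = (real n - 1) * f x + r x"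
    "\<And>x. frechet_derivative g (at x) x = (real n - 1) * g x + q x" by auto
  then show ?case
    by (intro exI[of _ "\<lambda>x. r x + q x"])
      (simp add: frechet_add[OF add.hyps] deg_less.add, simp add: algebra_simps)
qed

lemma linear_frechet: "deg_less n f \<Longrightarrow> linear (frechet_derivative f (at x))"
  using deg_less_has_derivative has_derivative_linear by blast

lemma sum_Basis_3:
  fixes F :: "real^3 \<Rightarrow> 'a::comm_monoid_add"
  shows "(\<Sum>w\<in>Basis. F w) = F (axis 1 1) + F (axis 2 1) + F (axis 3 1)"
proof -
  have B: "Basis = {axis 1 1, axis 2 1, axis 3 1 :: real^3}"
    by (auto simp: Basis_vec_def UNIV_3)
  show ?thesis unfolding B by (simp add: axis_eq_axis add.assoc)
qed

text \<open>
The vectors \<open>w \<times> x\<close>, for \<open>w\<close> in an orthonormal basis, form a tight frame of the plane orthogonal to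
\<open>x\<close>: the left side is \<open>|x|\<^sup>2\<close> times the projection of \<open>v\<close> to that plane.
\<close>

lemma cross_Basis_expand:
  "(\<Sum>w\<in>Basis. (v \<bullet> cross3 w x) *\<^sub>R cross3 w x) = (x \<bullet> x) *\<^sub>R v - (v \<bullet> x) *\<^sub>R x"
  by (simp add: sum_Basis_3 cross3_def vec_eq_iff forall_3 inner_vec_def sum_3 axis_def algebra_simps)

lemma cross_cross_Basis:
  "(\<Sum>w\<in>Basis. cross3 (cross3 v w) w) = (-2) *\<^sub>R (v::real^3)"
  by (simp add: sum_Basis_3 cross3_def vec_eq_iff forall_3 inner_vec_def sum_3 axis_def)

text \<open>
The product rule for a second-order operator. The linear function \<open>v \<bullet> x\<close> is an eigenfunction for
\<open>-2\<close>, and the mixed term is given by the frame identity for the rotation fields.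
\<close>

lemma lap_linear_mult:
  assumes "deg_less n f"
  shows "lap (\<lambda>x. (v \<bullet> x) * f x) x = - 2 * (v \<bullet> x) * f x
    + 2 * ((x \<bullet> x) * frechet_derivative f (at x) v - (v \<bullet> x) * frechet_derivative f (at x) x)
    + (v \<bullet> x) * lap f x"
proof -
  note r = deg_less_rot[OF assms]
  have 1: "rot w (rot w (\<lambda>x. (v \<bullet> x) * f x)) x =
     (cross3 (cross3 v w) w \<bullet> x) * f x + 2 * ((v \<bullet> cross3 w x) * rot w f x) + (v \<bullet> x) * rot w (rot w f) x" for w
    by (simp add: rot_linear_mult[OF assms] rot_linear_mult[OF r]
        rot_add[OF deg_less.linear[OF assms] deg_less.linear[OF r]] cross_triple')
  have 2: "(\<Sum>w\<in>Basis. (v \<bullet> cross3 w x) * rot w f x)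
      = frechet_derivative f (at x) (\<Sum>w\<in>Basis. (v \<bullet> cross3 w x) *\<^sub>R cross3 w x)"
    by (simp add: rot_def linear_sum[OF linear_frechet[OF assms]] linear_scale[OF linear_frechet[OF assms]])
  have 3: "(\<Sum>w\<in>Basis. cross3 (cross3 v w) w \<bullet> x) = (\<Sum>w\<in>Basis. cross3 (cross3 v w) w) \<bullet> x"
    by (simp add: inner_sum_left)
  show ?thesis
    unfolding lap_def 1 sum.distrib sum_distrib_left[symmetric] sum_distrib_right[symmetric] 2 3
      cross_Basis_expand cross_cross_Basis
    by (simp add: linear_diff[OF linear_frechet[OF assms]] linear_scale[OF linear_frechet[OF assms]])
qed

lemma lap_add:
  assumes "deg_less m f" "deg_less n g"
  shows "lap (\<lambda>x. f x + g x) x = lap f x + lap g x"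
  by (simp add: lap_def rot_add[OF assms] rot_add[OF deg_less_rot[OF assms(1)] deg_less_rot[OF assms(2)]] sum.distrib)

text \<open>
On homogeneous polynomials of degree \<open>n - 1\<close> the Laplacian of the sphere is the Euclidean one, which
lowers the degree by two, minus \<open>(n - 1) n\<close>. The induction on the construction of polynomials needs
only leading terms: multiplication by a linear function changes the eigenvalue from \<open>(n - 1) n\<close> to
\<open>(n - 1) n + 2 (n - 1) + 2 = n (n + 1)\<close>, the middle term coming from Euler's identity.
\<close>

lemma lap_leading:
  "deg_less n f \<Longrightarrow> \<exists>r. deg_less (n - 1) r \<and>
     (\<forall>x\<in>sphere 0 1. lap f x = - ((real n - 1) * real n) * f x + r x)"
proof (induction rule: deg_less.induct)
  case (zero n)
  then show ?case by (intro exI[of _ "\<lambda>x. 0"]) (auto intro: deg_less.intros simp: lap_def)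
next
  case (const n c)
  have "deg_less n (\<lambda>x. real n * (real n + 1) * c)" by (cases n) (auto intro: deg_less.intros)
  then show ?case by (intro exI[of _ "\<lambda>x. real n * (real n + 1) * c"]) (auto simp: lap_def algebra_simps)
next
  case (linear n f v)
  obtain r where r: "deg_less (n - 1) r"
    "\<And>x. frechet_derivative f (at x) x = (real n - 1) * f x + r x"
    using euler_leading[OF linear.hyps] by auto
  obtain q where q: "deg_less (n - 1) q"
    "\<And>x. x \<in> sphere 0 1 \<Longrightarrow> lap f x = - ((real n - 1) * real n) * f x + q x"
    using linear.IH by blast
  show ?case
  proof (cases n)
    case 0
    then show ?thesis using deg_less_0[OF linear.hyps]
      by (intro exI[of _ "\<lambda>x. 0"]) (auto intro: deg_less.intros simp: lap_def)
  next
    case (Suc m)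
    define p where "p x = 2 * frechet_derivative f (at x) v + ((-2) * ((v \<bullet> x) * r x) + (v \<bullet> x) * q x)" for x
    have "deg_less n p" unfolding p_def[abs_def]
      using r(1) q(1) Suc deg_less_Suc[OF deg_less_frechet[OF linear.hyps, of v]]
      by (intro deg_less.add deg_less_scale) (auto intro: deg_less.intros)
    moreover have "lap (\<lambda>x. (v \<bullet> x) * f x) x = - (real n * (real n + 1)) * ((v \<bullet> x) * f x) + p x"
      if "x \<in> sphere 0 1" for x
    proof -
      have "x \<bullet> x = 1" using that by (simp add: dot_square_norm)
      then show ?thesis
        unfolding lap_linear_mult[OF linear.hyps] r(2) q(2)[OF that] p_def by (simp add: algebra_simps)
    qed
    ultimately show ?thesis by (intro exI[of _ p]) (auto simp: mult.commute)
  qed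
next
  case (add n f g)
  then obtain r q where "deg_less (n - 1) r" "deg_less (n - 1) q"
    "\<forall>x\<in>sphere 0 1. lap f x = - ((real n - 1) * real n) * f x + r x"
    "\<forall>x\<in>sphere 0 1. lap g x = - ((real n - 1) * real n) * g x + q x" by auto
  then show ?case
    by (intro exI[of _ "\<lambda>x. r x + q x"])
      (simp add: lap_add[OF add.hyps] deg_less.add, simp add: algebra_simps)
qed

section \<open>The space of square-integrable functions on the sphere\<close>

lemma finite_measure_sphere2: "finite_measure sphere2"
  by (rule finite_measureI) (simp add: emeasure_sphere2_total)

interpretation sphere2: finite_measure sphere2
  by (rule finite_measure_sphere2)

lemma measure_sphere2_total: "measure sphere2 (sphere 0 1) = 4 * pi"
  by (simp add: measure_def emeasure_sphere2_total)

lemma borel_measurable_sphere2_continuous: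
  fixes f :: "real^3 \<Rightarrow> 'b::topological_space"
  shows "continuous_on (sphere 0 1) f \<Longrightarrow> f \<in> borel_measurable sphere2"
  using borel_measurable_continuous_on_restrict measurable_cong_sets[OF sets_sphere2 refl] by blast

lemma integrable_sphere2_bounded:
  fixes f :: "real^3 \<Rightarrow> 'b::{banach,second_countable_topology}"
  assumes "f \<in> borel_measurable sphere2" "\<And>s. s \<in> sphere 0 1 \<Longrightarrow> norm (f s) \<le> B"
  shows "integrable sphere2 f"
  using assms by (intro sphere2.integrable_const_bound[of f B]) (auto intro!: AE_I2)

lemma integrable_sphere2_continuous:
  fixes f :: "real^3 \<Rightarrow> real"
  assumes "continuous_on (sphere 0 1) f"
  shows "integrable sphere2 f"
proof -
  have "bounded (f ` sphere 0 1)"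
    using assms by (intro compact_imp_bounded compact_continuous_image) auto
  then obtain B where "\<forall>y\<in>f ` sphere 0 1. norm y \<le> B" unfolding bounded_iff ..
  then have "norm (f s) \<le> B" if "s \<in> sphere 0 1" for s using that by blast
  then show ?thesis
    using assms by (intro integrable_sphere2_bounded borel_measurable_sphere2_continuous)
qed

lemma sphere_L2_iff:
  fixes f :: "real^3 \<Rightarrow> real"
  shows "f \<in> sphere_L2 \<longleftrightarrow> f \<in> borel_measurable sphere2 \<and> integrable sphere2 (\<lambda>s. (f s)\<^sup>2)"
  by (simp add: sphere_L2_def)

text \<open>
The surface measure is finite.
\<close>

lemma sphere_L2_bounded:
  fixes f :: "real^3 \<Rightarrow> real"
  assumes m: "f \<in> borel_measurable sphere2" and B: "\<And>s. s \<in> sphere 0 1 \<Longrightarrow> \<bar>f s\<bar> \<le> B"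
  shows "f \<in> sphere_L2"
  unfolding sphere_L2_iff
proof (intro conjI m integrable_sphere2_bounded[where B = "B\<^sup>2"] borel_measurable_power)
  fix s :: "real^3" assume "s \<in> sphere 0 1"
  then have "\<bar>f s\<bar>\<^sup>2 \<le> B\<^sup>2" using B by (intro power_mono) auto
  then show "norm ((f s)\<^sup>2) \<le> B\<^sup>2" by simp
qed

lemma sphere_L2_continuous:
  fixes f :: "real^3 \<Rightarrow> real"
  shows "continuous_on (sphere 0 1) f \<Longrightarrow> f \<in> sphere_L2"
  unfolding sphere_L2_iff
  by (intro conjI borel_measurable_sphere2_continuous integrable_sphere2_continuous continuous_intros)

lemma sphere_L2_deg_less: "deg_less n f \<Longrightarrow> f \<in> sphere_L2"
  by (intro sphere_L2_continuous deg_less_continuous_on)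

lemma sphere_L2_const: "(\<lambda>s. c :: real) \<in> sphere_L2"
  by (intro sphere_L2_continuous continuous_intros)

lemma sphere_L2_mult_integrable:
  fixes f g :: "real^3 \<Rightarrow> real"
  assumes "f \<in> sphere_L2" "g \<in> sphere_L2"
  shows "integrable sphere2 (\<lambda>s. f s * g s)"
proof (rule Bochner_Integration.integrable_bound)
  show "integrable sphere2 (\<lambda>s. (f s)\<^sup>2 + (g s)\<^sup>2)"
    using assms by (auto simp: sphere_L2_iff)
  show "AE s in sphere2. norm (f s * g s) \<le> norm ((f s)\<^sup>2 + (g s)\<^sup>2)"
  proof (rule AE_I2)
    fix s
    have "2 * (\<bar>f s\<bar> * \<bar>g s\<bar>) \<le> (f s)\<^sup>2 + (g s)\<^sup>2"
      using sum_squares_bound[of "\<bar>f s\<bar>" "\<bar>g s\<bar>"] by simp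
    moreover have "0 \<le> \<bar>f s\<bar> * \<bar>g s\<bar>" by simp
    ultimately have "\<bar>f s\<bar> * \<bar>g s\<bar> \<le> (f s)\<^sup>2 + (g s)\<^sup>2" by linarith
    then show "norm (f s * g s) \<le> norm ((f s)\<^sup>2 + (g s)\<^sup>2)" by (simp add: abs_mult)
  qed
qed (use assms in \<open>auto simp: sphere_L2_iff\<close>)

lemma sphere_L2_add:
  fixes f g :: "real^3 \<Rightarrow> real"
  assumes "f \<in> sphere_L2" "g \<in> sphere_L2"
  shows "(\<lambda>s. f s + g s) \<in> sphere_L2"
proof -
  have "integrable sphere2 (\<lambda>s. (f s)\<^sup>2 + (g s)\<^sup>2 + 2 * (f s * g s))"
    using assms sphere_L2_mult_integrable[OF assms] by (auto simp: sphere_L2_iff)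
  then show ?thesis using assms by (auto simp: sphere_L2_iff power2_sum mult.assoc)
qed

lemma sphere_L2_scale:
  fixes f :: "real^3 \<Rightarrow> real"
  shows "f \<in> sphere_L2 \<Longrightarrow> (\<lambda>s. c * f s) \<in> sphere_L2"
  by (auto simp: sphere_L2_iff power_mult_distrib)

lemma sphere_L2_diff:
  fixes f g :: "real^3 \<Rightarrow> real"
  shows "f \<in> sphere_L2 \<Longrightarrow> g \<in> sphere_L2 \<Longrightarrow> (\<lambda>s. f s - g s) \<in> sphere_L2"
  using sphere_L2_add[of f "\<lambda>s. (-1) * g s"] sphere_L2_scale[of g "-1"] by simp

lemma sphere_L2_sum:
  fixes f :: "'i \<Rightarrow> real^3 \<Rightarrow> real"
  shows "(\<And>i. i \<in> I \<Longrightarrow> f i \<in> sphere_L2) \<Longrightarrow> (\<lambda>s. \<Sum>i\<in>I. f i s) \<in> sphere_L2"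
  by (induction I rule: infinite_finite_induct) (auto intro: sphere_L2_add sphere_L2_const)

text \<open>
The inner product of \<open>L\<^sup>2\<close> over the sphere.
\<close>

definition ip :: "(real^3 \<Rightarrow> real) \<Rightarrow> (real^3 \<Rightarrow> real) \<Rightarrow> real" where
  "ip f g = (LINT s|sphere2. f s * g s)"

lemma ip_commute: "ip f g = ip g f"
  by (simp add: ip_def mult.commute)

lemma ip_cong:
  "(\<And>s. s \<in> sphere 0 1 \<Longrightarrow> f s = f' s) \<Longrightarrow> (\<And>s. s \<in> sphere 0 1 \<Longrightarrow> g s = g' s) \<Longrightarrow> ip f g = ip f' g'"
  unfolding ip_def by (intro Bochner_Integration.integral_cong) auto

lemma ip_add_left:
  "f \<in> sphere_L2 \<Longrightarrow> g \<in> sphere_L2 \<Longrightarrow> h \<in> sphere_L2 \<Longrightarrow> ip (\<lambda>s. f s + g s) h = ip f h + ip g h"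
  by (simp add: ip_def distrib_right sphere_L2_mult_integrable)

lemma ip_scale_left: "ip (\<lambda>s. c * f s) h = c * ip f h"
  by (simp add: ip_def mult.assoc)

lemma ip_diff_left:
  "f \<in> sphere_L2 \<Longrightarrow> g \<in> sphere_L2 \<Longrightarrow> h \<in> sphere_L2 \<Longrightarrow> ip (\<lambda>s. f s - g s) h = ip f h - ip g h"
  by (simp add: ip_def left_diff_distrib sphere_L2_mult_integrable)

lemma ip_sum_left:
  "(\<And>i. i \<in> I \<Longrightarrow> f i \<in> sphere_L2) \<Longrightarrow> h \<in> sphere_L2 \<Longrightarrow>
    ip (\<lambda>s. \<Sum>i\<in>I. f i s) h = (\<Sum>i\<in>I. ip (f i) h)"
  by (simp add: ip_def sum_distrib_right sphere_L2_mult_integrable)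

lemma ip_add_right:
  "f \<in> sphere_L2 \<Longrightarrow> g \<in> sphere_L2 \<Longrightarrow> h \<in> sphere_L2 \<Longrightarrow> ip h (\<lambda>s. f s + g s) = ip h f + ip h g"
  using ip_add_left[of f g h] by (simp add: ip_commute)

lemma ip_scale_right: "ip h (\<lambda>s. c * f s) = c * ip h f"
  using ip_scale_left[of c f h] by (simp add: ip_commute)

lemma ip_diff_right:
  "f \<in> sphere_L2 \<Longrightarrow> g \<in> sphere_L2 \<Longrightarrow> h \<in> sphere_L2 \<Longrightarrow> ip h (\<lambda>s. f s - g s) = ip h f - ip h g"
  using ip_diff_left[of f g h] by (simp add: ip_commute)

lemma ip_sum_right:
  "(\<And>i. i \<in> I \<Longrightarrow> f i \<in> sphere_L2) \<Longrightarrow> h \<in> sphere_L2 \<Longrightarrow>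
    ip h (\<lambda>s. \<Sum>i\<in>I. f i s) = (\<Sum>i\<in>I. ip h (f i))"
  using ip_sum_left[of I f h] by (simp add: ip_commute)

lemma ip_nonneg: "0 \<le> ip f f"
  by (simp add: ip_def)

lemma ip_self: "ip f f = (LINT s|sphere2. (f s)\<^sup>2)"
  by (simp add: ip_def power2_eq_square)

lemma ip_diff_self:
  assumes "f \<in> sphere_L2" "g \<in> sphere_L2"
  shows "ip (\<lambda>s. f s - g s) (\<lambda>s. f s - g s) = ip f f - 2 * ip f g + ip g g"
  using assms by (simp add: ip_diff_left ip_diff_right sphere_L2_diff ip_commute[of g f])

section \<open>Full support and rotation invariance of the surface measure\<close>

text \<open>
The cone over a relatively open piece of the sphere is open in space, hence has positive volume.
\<close>

lemma emeasure_sphere2_open_pos: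
  assumes "open U" "s \<in> U" "s \<in> sphere 0 1"
  shows "emeasure sphere2 (U \<inter> sphere 0 1) \<noteq> 0"
proof
  assume z: "emeasure sphere2 (U \<inter> sphere 0 1) = 0"
  let ?C = "{x \<in> ball 0 1 - {0::real^3}. sgn x \<in> U \<inter> sphere 0 1}"
  have "U \<inter> sphere 0 1 \<in> sets sphere2"
    using assms(1) by (auto simp: sets_sphere2 sets_restrict_space)
  from emeasure_sphere2[OF this] z have z': "emeasure lborel ?C = 0" by simp
  have C: "?C = sgn -` U \<inter> (ball 0 1 - {0})" by (auto simp: norm_sgn)
  have "continuous_on (ball 0 1 - {0::real^3}) sgn"
    unfolding sgn_div_norm[abs_def] by (intro continuous_intros) auto
  then have opn: "open ?C"
    unfolding C using continuous_on_open_vimage[THEN iffD1, OF open_delete[OF open_ball]] assms(1)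
    by blast
  moreover have "(1/2) *\<^sub>R s \<in> ?C"
    using assms by (auto simp: C sgn_div_norm)
  ultimately have "\<not> negligible ?C" using open_not_negligible by blast
  moreover have "?C \<in> null_sets lborel" using z' opn by (auto intro: null_setsI)
  ultimately show False by (simp add: negligible_iff_null_sets null_sets_completionI)
qed

text \<open>
This turns identities in \<open>L\<^sup>2\<close> between polynomials into pointwise identities on the sphere.
\<close>

lemma ip_self_eq_0:
  assumes c: "continuous_on (sphere 0 1) f" and 0: "ip f f = 0" and s: "s \<in> sphere 0 1"
  shows "f s = 0"
proof (rule ccontr)
  assume "f s \<noteq> 0"
  have fm: "f \<in> borel_measurable sphere2"
    using c by (rule borel_measurable_sphere2_continuous)
  have "f -` {0} \<inter> space sphere2 \<in> sets sphere2" by (rule measurable_sets[OF fm]) simp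
  then have "space sphere2 - f -` {0} \<inter> space sphere2 \<in> sets sphere2" by (rule sets.compl_sets)
  moreover have "space sphere2 - f -` {0} \<inter> space sphere2 = {s \<in> space sphere2. \<not> f s = 0}" by blast
  ultimately have meas: "{s \<in> space sphere2. \<not> f s = 0} \<in> sets sphere2" by (simp only:)
  have "AE s in sphere2. (f s)\<^sup>2 = 0"
    using 0 sphere_L2_continuous[OF c] unfolding ip_self
    by (subst integral_nonneg_eq_0_iff_AE[symmetric]) (auto simp: sphere_L2_iff)
  then have "AE s in sphere2. f s = 0" by simp
  then have ae: "emeasure sphere2 {s \<in> space sphere2. f s \<noteq> 0} = 0"
    unfolding AE_iff_measurable[OF meas refl] .
  obtain U where U: "open U" "U \<inter> sphere 0 1 = f -` (- {0}) \<inter> sphere 0 1"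
    using c[unfolded continuous_on_open_invariant, rule_format, OF open_Compl[OF closed_singleton[of 0]]]
    by (elim exE conjE)
  have "emeasure sphere2 (U \<inter> sphere 0 1) \<noteq> 0"
  proof (rule emeasure_sphere2_open_pos[OF U(1) _ s])
    have "s \<in> U \<inter> sphere 0 1" unfolding U(2) using s \<open>f s \<noteq> 0\<close> by blast
    then show "s \<in> U" by blast
  qed
  moreover have "{s \<in> space sphere2. f s \<noteq> 0} = U \<inter> sphere 0 1" unfolding U(2) space_sphere2 by blast
  ultimately show False using ae by simp
qed

lemma integral_sphere2_orthogonal:
  fixes f :: "real^3 \<Rightarrow> real"
  assumes T: "orthogonal_transformation T" and f: "f \<in> borel_measurable sphere2"
  shows "(LINT s|sphere2. f (T s)) = (LINT s|sphere2. f s)"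
proof -
  have nT: "norm (T x) = norm x" for x using T by (rule orthogonal_transformation_norm)
  have Tm [measurable]: "T \<in> sphere2 \<rightarrow>\<^sub>M sphere2"
    unfolding measurable_cong_sets[OF sets_sphere2 sets_sphere2]
    using linear_continuous_on[OF linear_conv_bounded_linear[THEN iffD1, OF orthogonal_transformation_linear[OF T]]]
    by (intro measurable_restrict_space2 borel_measurable_continuous_on_restrict)
      (auto simp: space_restrict_space nT)
  have "distr sphere2 sphere2 T = sphere2"
  proof (rule measure_eqI)
    fix A assume "A \<in> sets (distr sphere2 sphere2 T)"
    then have A: "A \<in> sets sphere2" by simp
    have pre: "T -` A \<inter> space sphere2 \<in> sets sphere2" using A by (rule measurable_sets[OF Tm])
    have sub: "A \<subseteq> sphere 0 1" using sets.sets_into_space[OF A] by simp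
    have img: "T ` (T -` A \<inter> space sphere2) = A"
    proof (intro equalityI subsetI)
      fix y assume y: "y \<in> A"
      obtain x where x: "y = T x" using orthogonal_transformation_surj[OF T] by (auto simp: surj_def)
      then have "norm x = 1" using y sub nT[of x] by auto
      then show "y \<in> T ` (T -` A \<inter> space sphere2)" using x y by auto
    qed auto
    have "emeasure sphere2 A = emeasure sphere2 (T -` A \<inter> space sphere2)"
      using emeasure_sphere2_rotation[OF T pre] A by (simp only: img)
    then show "emeasure (distr sphere2 sphere2 T) A = emeasure sphere2 A"
      using A by (simp add: emeasure_distr)
  qed simp
  then show ?thesis using integral_distr[OF Tm f] by simp
qed

section \<open>Skew-symmetry of the generators of rotations\<close>

text \<open>
Rodrigues' formula: the rotation by the angle \<open>t\<close> about the unit vector \<open>w\<close>, that is, the flow at time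
\<open>t\<close> of the field \<open>x \<mapsto> w \<times> x\<close>.
\<close>

definition rodrigues :: "real^3 \<Rightarrow> real \<Rightarrow> real^3 \<Rightarrow> real^3" where
  "rodrigues w t x = cos t *\<^sub>R x + sin t *\<^sub>R cross3 w x + ((1 - cos t) * (w \<bullet> x)) *\<^sub>R w"

lemma orthogonal_transformation_rodrigues:
  assumes "norm w = 1"
  shows "orthogonal_transformation (rodrigues w t)"
  unfolding orthogonal_transformation
proof (intro conjI allI)
  show "linear (rodrigues w t)"
    unfolding rodrigues_def
    by (rule linearI) (simp_all add: cross_add_right cross_mult_right inner_add_right algebra_simps)
  fix x
  have ww: "w \<bullet> w = 1" using assms by (simp add: dot_square_norm)
  have cc: "cross3 w x \<bullet> cross3 w x = x \<bullet> x - (w \<bullet> x)\<^sup>2"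
    unfolding dot_cross by (simp add: ww power2_eq_square inner_commute)
  have "rodrigues w t x \<bullet> rodrigues w t x = (cos t)\<^sup>2 * (x \<bullet> x) + (sin t)\<^sup>2 * (cross3 w x \<bullet> cross3 w x)
      + (1 - cos t)\<^sup>2 * (w \<bullet> x)\<^sup>2 * (w \<bullet> w) + 2 * cos t * (1 - cos t) * (w \<bullet> x)\<^sup>2"
    unfolding rodrigues_def
    by (simp add: inner_add_left inner_add_right dot_cross_self inner_commute[of x w] power2_eq_square algebra_simps)
  also have "\<dots> = x \<bullet> x"
    unfolding cc ww sin_squared_eq by (simp add: power2_eq_square algebra_simps)
  finally show "norm (rodrigues w t x) = norm x"
    by (simp add: norm_eq_sqrt_inner)
qed

lemma has_vector_derivative_rodrigues:
  assumes "norm w = 1"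
  shows "((\<lambda>t. rodrigues w t x) has_vector_derivative cross3 w (rodrigues w t x)) (at t)"
proof -
  have ww: "w \<bullet> w = 1" using assms by (simp add: dot_square_norm)
  have "cross3 w (rodrigues w t x) = (- sin t) *\<^sub>R x + cos t *\<^sub>R cross3 w x + (sin t * (w \<bullet> x)) *\<^sub>R w"
    unfolding rodrigues_def
    by (simp add: cross_add_right cross_mult_right Lagrange ww scaleR_diff_right mult.commute)
  moreover have "((\<lambda>t. rodrigues w t x) has_vector_derivative
      (- sin t) *\<^sub>R x + cos t *\<^sub>R cross3 w x + (sin t * (w \<bullet> x)) *\<^sub>R w) (at t)"
    unfolding rodrigues_def has_vector_derivative_def
    by (auto intro!: derivative_eq_intros simp: algebra_simps)
  ultimately show ?thesis by simp
qed

lemma rodrigues_0 [simp]: "rodrigues w 0 x = x"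
  by (simp add: rodrigues_def)

lemma DERIV_rodrigues:
  assumes "norm w = 1" "deg_less n f"
  shows "((\<lambda>t. f (rodrigues w t x)) has_real_derivative rot w f (rodrigues w t x)) (at t)"
proof -
  have "((\<lambda>t. f (rodrigues w t x)) has_derivative
      (\<lambda>h. frechet_derivative f (at (rodrigues w t x)) (h *\<^sub>R cross3 w (rodrigues w t x)))) (at t)"
    using has_derivative_compose[OF has_vector_derivative_rodrigues[OF assms(1), unfolded has_vector_derivative_def]
        deg_less_has_derivative[OF assms(2)]] .
  then show ?thesis
    by (simp add: has_field_derivative_def rot_def linear_scale[OF linear_frechet[OF assms(2)]] mult_commute_abs)
qed

text \<open>
The integral of \<open>f\<close> along the rotation flow is constant in time by invariance of the measure, and
\<open>rot w f\<close> is the time derivative of the integrand at 0. The derivative is exchanged with the integral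
by dominated convergence of difference quotients, which the mean value theorem bounds by the maximum
of \<open>rot w f\<close> on the sphere.
\<close>

lemma integral_rot_eq_0:
  assumes w: "norm w = 1" and f: "deg_less n f"
  shows "(LINT s|sphere2. rot w f s) = 0"
proof -
  \<comment> \<open>difference quotients for the times \<open>1 / (i + 1)\<close>\<close>
  define d where "d i s = real (Suc i) * (f (rodrigues w (1 / real (Suc i)) s) - f s)" for i s
  have T: "orthogonal_transformation (rodrigues w t)" for t
    using w by (rule orthogonal_transformation_rodrigues)
  have nT: "norm (rodrigues w t x) = norm x" for t x
    using T by (rule orthogonal_transformation_norm)
  note cf = deg_less_continuous_on[OF f]
  have fT: "deg_less n (\<lambda>s. f (rodrigues w t s))" for t
    by (rule deg_less_compose_linear[OF orthogonal_transformation_linear[OF T] f])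
  have d_int: "(LINT s|sphere2. d i s) = 0" for i
    using integral_sphere2_orthogonal[OF T borel_measurable_sphere2_continuous[OF cf], of "1 / real (Suc i)"]
    unfolding d_def
    by (simp add: Bochner_Integration.integral_diff integrable_sphere2_continuous
        deg_less_continuous_on[OF fT] cf del: of_nat_Suc)
  have "bounded (rot w f ` sphere 0 1)"
    by (intro compact_imp_bounded compact_continuous_image deg_less_continuous_on[OF deg_less_rot[OF f]]) auto
  then obtain B where "\<forall>y\<in>rot w f ` sphere 0 1. norm y \<le> B" unfolding bounded_iff ..
  then have B: "\<bar>rot w f s\<bar> \<le> B" if "norm s = 1" for s using that by auto
  have "(\<lambda>i. LINT s|sphere2. d i s) \<longlonglongrightarrow> (LINT s|sphere2. rot w f s)"
  proof (rule integral_dominated_convergence[where w = "\<lambda>_. B"])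
    show "rot w f \<in> borel_measurable sphere2"
      by (intro borel_measurable_sphere2_continuous deg_less_continuous_on[OF deg_less_rot[OF f]])
    show "d i \<in> borel_measurable sphere2" for i
      unfolding d_def
      by (intro borel_measurable_sphere2_continuous continuous_intros deg_less_continuous_on[OF fT] cf)
    show "AE s in sphere2. (\<lambda>i. d i s) \<longlonglongrightarrow> rot w f s"
    proof (rule AE_I2)
      fix s
      have "((\<lambda>h. (f (rodrigues w h s) - f s) / h) \<longlongrightarrow> rot w f s) (at 0)"
        using DERIV_rodrigues[OF w f, of s 0] by (simp add: DERIV_def)
      moreover have "filterlim (\<lambda>i. 1 / real (Suc i)) (at 0) sequentially"
        using LIMSEQ_inverse_real_of_nat
        by (auto simp: filterlim_at inverse_eq_divide)
      ultimately have "(\<lambda>i. (f (rodrigues w (1 / real (Suc i)) s) - f s) / (1 / real (Suc i)))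
          \<longlonglongrightarrow> rot w f s"
        by (rule filterlim_compose)
      then show "(\<lambda>i. d i s) \<longlonglongrightarrow> rot w f s" by (simp add: d_def mult.commute)
    qed
    show "AE s in sphere2. norm (d i s) \<le> B" for i
    proof (rule AE_I2)
      fix s assume "s \<in> space sphere2"
      then have s: "norm s = 1" by simp
      obtain z where "f (rodrigues w (1 / real (Suc i)) s) - f (rodrigues w 0 s)
          = (1 / real (Suc i) - 0) * rot w f (rodrigues w z s)"
        using MVT2[of 0 "1 / real (Suc i)" "\<lambda>t. f (rodrigues w t s)" "\<lambda>t. rot w f (rodrigues w t s)"]
          DERIV_rodrigues[OF w f, of s] by auto
      then have "d i s = rot w f (rodrigues w z s)" by (simp add: d_def del: of_nat_Suc)
      then show "norm (d i s) \<le> B" using B[of "rodrigues w z s"] by (simp add: nT s)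
    qed
  qed simp
  then show ?thesis unfolding d_int using LIMSEQ_unique tendsto_const by blast
qed

text \<open>
Integration by parts: apply the vanishing of the integral to the product \<open>f g\<close>.
\<close>

lemma ip_rot:
  assumes w: "norm w = 1" and f: "deg_less m f" and g: "deg_less n g"
  shows "ip (rot w f) g = - ip f (rot w g)"
proof -
  have "0 = (LINT s|sphere2. rot w (\<lambda>s. f s * g s) s)"
    using integral_rot_eq_0[OF w deg_less_mult[OF f g]] by simp
  also have "\<dots> = (LINT s|sphere2. f s * rot w g s + rot w f s * g s)"
    unfolding rot_mult[OF f g] ..
  also have "\<dots> = ip f (rot w g) + ip (rot w f) g"
    unfolding ip_def
    by (intro Bochner_Integration.integral_add sphere_L2_mult_integrable)
      (auto intro: sphere_L2_deg_less deg_less_rot f g)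
  finally show ?thesis by simp
qed

lemma ip_rot_rot:
  assumes f: "deg_less m f" and g: "deg_less n g"
  shows "(\<Sum>w\<in>Basis. ip (rot w f) (rot w g)) = - ip f (lap g)"
proof -
  have "ip f (lap g) = (\<Sum>w\<in>Basis. ip f (rot w (rot w g)))"
    unfolding lap_def[abs_def]
    by (intro ip_sum_right) (auto intro: sphere_L2_deg_less deg_less_rot f g)
  then show ?thesis
    by (simp add: ip_rot[OF _ f deg_less_rot[OF g]] sum_negf)
qed

lemma ip_lap:
  assumes f: "deg_less m f" and g: "deg_less n g"
  shows "ip (lap f) g = ip f (lap g)"
  using ip_rot_rot[OF f g] ip_rot_rot[OF g f] by (simp add: ip_commute)

section \<open>Density of polynomials\<close>

text \<open>
Membership in the closure of the polynomials in \<open>L\<^sup>2\<close>.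
\<close>

definition poly_approx :: "(real^3 \<Rightarrow> real) \<Rightarrow> bool" where
  "poly_approx f \<longleftrightarrow> f \<in> sphere_L2 \<and>
     (\<forall>e>0. \<exists>n p. deg_less n p \<and> ip (\<lambda>s. f s - p s) (\<lambda>s. f s - p s) < e)"

lemma ip_add_self_le:
  assumes "f \<in> sphere_L2" "g \<in> sphere_L2"
  shows "ip (\<lambda>s. f s + g s) (\<lambda>s. f s + g s) \<le> 2 * ip f f + 2 * ip g g"
proof -
  have "ip (\<lambda>s. f s + g s) (\<lambda>s. f s + g s) = ip f f + 2 * ip f g + ip g g"
    using assms by (simp add: ip_add_left ip_add_right sphere_L2_add ip_commute[of g f])
  moreover have "0 \<le> ip f f - 2 * ip f g + ip g g"
    using ip_diff_self[OF assms] ip_nonneg by metis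
  ultimately show ?thesis by linarith
qed

lemma ip_triangle_le:
  assumes "f \<in> sphere_L2" "g \<in> sphere_L2" "h \<in> sphere_L2"
  shows "ip (\<lambda>s. f s - h s) (\<lambda>s. f s - h s)
    \<le> 2 * ip (\<lambda>s. f s - g s) (\<lambda>s. f s - g s) + 2 * ip (\<lambda>s. g s - h s) (\<lambda>s. g s - h s)"
  using ip_add_self_le[OF sphere_L2_diff[OF assms(1,2)] sphere_L2_diff[OF assms(2,3)]] by simp

lemma poly_approx_add:
  assumes f: "poly_approx f" and g: "poly_approx g"
  shows "poly_approx (\<lambda>s. f s + g s)"
  unfolding poly_approx_def
proof (intro conjI allI impI)
  have L2: "f \<in> sphere_L2" "g \<in> sphere_L2" using f g by (auto simp: poly_approx_def)
  then show "(\<lambda>s. f s + g s) \<in> sphere_L2" by (rule sphere_L2_add)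
  fix e :: real assume "e > 0"
  then have "e / 4 > 0" by simp
  with f g obtain m p n q where p: "deg_less m p" "ip (\<lambda>s. f s - p s) (\<lambda>s. f s - p s) < e / 4"
    and q: "deg_less n q" "ip (\<lambda>s. g s - q s) (\<lambda>s. g s - q s) < e / 4"
    unfolding poly_approx_def by meson
  have "ip (\<lambda>s. (f s - p s) + (g s - q s)) (\<lambda>s. (f s - p s) + (g s - q s)) < e"
    using ip_add_self_le[OF sphere_L2_diff[OF L2(1) sphere_L2_deg_less[OF p(1)]]
        sphere_L2_diff[OF L2(2) sphere_L2_deg_less[OF q(1)]]] p(2) q(2) by simp
  moreover have "deg_less (max m n) (\<lambda>s. p s + q s)"
    by (intro deg_less.add) (auto intro: deg_less_mono p(1) q(1))
  ultimately show "\<exists>n r. deg_less n r \<and>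
      ip (\<lambda>s. f s + g s - r s) (\<lambda>s. f s + g s - r s) < e"
    by (intro exI[of _ "max m n"] exI[of _ "\<lambda>s. p s + q s"]) (simp add: algebra_simps)
qed

lemma poly_approx_scale:
  assumes f: "poly_approx f"
  shows "poly_approx (\<lambda>s. c * f s)"
  unfolding poly_approx_def
proof (intro conjI allI impI)
  show "(\<lambda>s. c * f s) \<in> sphere_L2" using f by (auto simp: poly_approx_def intro: sphere_L2_scale)
  fix e :: real assume "e > 0"
  then have "e / (c\<^sup>2 + 1) > 0" by (simp add: add_nonneg_pos)
  then obtain n p where p: "deg_less n p" "ip (\<lambda>s. f s - p s) (\<lambda>s. f s - p s) < e / (c\<^sup>2 + 1)"
    using f unfolding poly_approx_def by blast
  have "ip (\<lambda>s. c * f s - c * p s) (\<lambda>s. c * f s - c * p s) = c\<^sup>2 * ip (\<lambda>s. f s - p s) (\<lambda>s. f s - p s)"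
    by (simp add: ip_scale_left ip_scale_right power2_eq_square flip: right_diff_distrib)
  also have "\<dots> \<le> (c\<^sup>2 + 1) * ip (\<lambda>s. f s - p s) (\<lambda>s. f s - p s)"
    by (intro mult_right_mono ip_nonneg) simp
  also have "\<dots> < (c\<^sup>2 + 1) * (e / (c\<^sup>2 + 1))"
    using p(2) by (intro mult_strict_left_mono) (auto simp: add_nonneg_pos)
  also have "\<dots> = e" by (simp add: add_nonneg_eq_0_iff)
  finally show "\<exists>n r. deg_less n r \<and> ip (\<lambda>s. c * f s - r s) (\<lambda>s. c * f s - r s) < e"
    using deg_less_scale[OF p(1)] by blast
qed

lemma poly_approx_sum:
  "(\<And>i. i \<in> I \<Longrightarrow> poly_approx (f i)) \<Longrightarrow> poly_approx (\<lambda>s. \<Sum>i\<in>I. f i s)"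
proof (induction I rule: infinite_finite_induct)
  have "poly_approx (\<lambda>s. 0)"
    unfolding poly_approx_def
    by (auto simp: sphere_L2_const ip_def intro!: exI[of _ 0] exI[of _ "\<lambda>_. 0"] deg_less.zero)
  then show "poly_approx (\<lambda>s. \<Sum>i\<in>{}. f i s)" "\<And>A. infinite A \<Longrightarrow> poly_approx (\<lambda>s. \<Sum>i\<in>A. f i s)"
    by auto
qed (auto intro: poly_approx_add)

lemma poly_approx_continuous:
  assumes f: "continuous_on (sphere 0 1) f"
  shows "poly_approx f"
  unfolding poly_approx_def
proof (intro conjI allI impI sphere_L2_continuous f)
  fix e :: real assume "e > 0"
  \<comment> \<open>uniform distance \<open>\<surd>(e / 8\<pi>)\<close> on a sphere of area \<open>4\<pi>\<close> gives squared norm at most \<open>e / 2\<close>\<close>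
  then have d: "sqrt (e / (8 * pi)) > 0" by simp
  obtain p where p: "real_polynomial_function p"
    "\<And>s. s \<in> sphere 0 1 \<Longrightarrow> \<bar>f s - p s\<bar> < sqrt (e / (8 * pi))"
    using Stone_Weierstrass_real_polynomial_function[OF _ f d] by auto
  obtain n where n: "deg_less n p" using real_polynomial_function_deg_less[OF p(1)] by blast
  have "ip (\<lambda>s. f s - p s) (\<lambda>s. f s - p s) \<le> (LINT s|sphere2. e / (8 * pi))"
    unfolding ip_self
  proof (rule integral_mono)
    show "integrable sphere2 (\<lambda>s. (f s - p s)\<^sup>2)"
      by (intro integrable_sphere2_continuous continuous_intros f deg_less_continuous_on[OF n])
    fix s assume "s \<in> space sphere2"
    then have "\<bar>f s - p s\<bar> \<le> sqrt (e / (8 * pi))" using p(2) by (simp add: less_imp_le)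
    then have "\<bar>f s - p s\<bar>\<^sup>2 \<le> (sqrt (e / (8 * pi)))\<^sup>2" by (intro power_mono) auto
    then show "(f s - p s)\<^sup>2 \<le> e / (8 * pi)" using \<open>e > 0\<close> by simp
  qed simp
  also have "\<dots> = e / 2" by (simp add: measure_sphere2_total)
  finally show "\<exists>n p. deg_less n p \<and> ip (\<lambda>s. f s - p s) (\<lambda>s. f s - p s) < e"
    using n \<open>e > 0\<close> by (intro exI[of _ n] exI[of _ p]) auto
qed

lemma poly_approx_closed:
  assumes f: "f \<in> sphere_L2" and h: "\<And>e. e > 0 \<Longrightarrow> \<exists>h. poly_approx h \<and> ip (\<lambda>s. f s - h s) (\<lambda>s. f s - h s) < e"
  shows "poly_approx f"
  unfolding poly_approx_def
proof (intro conjI allI impI f)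
  fix e :: real assume "e > 0"
  then have "e / 4 > 0" by simp
  then obtain h where h: "poly_approx h" "ip (\<lambda>s. f s - h s) (\<lambda>s. f s - h s) < e / 4"
    using h by blast
  then obtain n p where p: "deg_less n p" "ip (\<lambda>s. h s - p s) (\<lambda>s. h s - p s) < e / 4"
    using \<open>e / 4 > 0\<close> unfolding poly_approx_def by blast
  have "ip (\<lambda>s. f s - p s) (\<lambda>s. f s - p s) < e"
    using ip_triangle_le[OF f _ sphere_L2_deg_less[OF p(1)], of h] h p by (simp add: poly_approx_def)
  then show "\<exists>n p. deg_less n p \<and> ip (\<lambda>s. f s - p s) (\<lambda>s. f s - p s) < e"
    using p(1) by blast
qed

lemma poly_approx_dominated:
  assumes f: "f \<in> sphere_L2" and w: "w \<in> sphere_L2" and h: "\<And>i. poly_approx (h i)"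
    and lim: "\<And>s. s \<in> sphere 0 1 \<Longrightarrow> (\<lambda>i. h i s) \<longlonglongrightarrow> f s"
    and bound: "\<And>i s. s \<in> sphere 0 1 \<Longrightarrow> \<bar>h i s\<bar> \<le> w s"
  shows "poly_approx f"
proof (rule poly_approx_closed[OF f])
  fix e :: real assume "e > 0"
  have m: "f \<in> borel_measurable sphere2" "\<And>i. h i \<in> borel_measurable sphere2"
    using f h by (auto simp: poly_approx_def sphere_L2_iff)
  have "(\<lambda>i. LINT s|sphere2. (f s - h i s)\<^sup>2) \<longlonglongrightarrow> (LINT s|sphere2. 0)"
  proof (rule integral_dominated_convergence[where w = "\<lambda>s. 2 * (f s)\<^sup>2 + 2 * (w s)\<^sup>2"])
    show "(\<lambda>s. (f s - h i s)\<^sup>2) \<in> borel_measurable sphere2" for i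
      by (intro borel_measurable_power borel_measurable_diff m)
    show "integrable sphere2 (\<lambda>s. 2 * (f s)\<^sup>2 + 2 * (w s)\<^sup>2)" using f w by (auto simp: sphere_L2_iff)
    show "AE s in sphere2. (\<lambda>i. (f s - h i s)\<^sup>2) \<longlonglongrightarrow> 0"
    proof (rule AE_I2)
      fix s assume "s \<in> space sphere2"
      then have "(\<lambda>i. (f s - h i s)\<^sup>2) \<longlonglongrightarrow> (f s - f s)\<^sup>2"
        using lim by (intro tendsto_intros) auto
      then show "(\<lambda>i. (f s - h i s)\<^sup>2) \<longlonglongrightarrow> 0" by simp
    qed
    show "AE s in sphere2. norm ((f s - h i s)\<^sup>2) \<le> 2 * (f s)\<^sup>2 + 2 * (w s)\<^sup>2" for i
    proof (rule AE_I2)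
      fix s assume "s \<in> space sphere2"
      then have "\<bar>h i s\<bar>\<^sup>2 \<le> (w s)\<^sup>2" using bound by (intro power_mono) auto
      moreover have "0 \<le> (f s + h i s)\<^sup>2" by simp
      then have "(f s - h i s)\<^sup>2 \<le> 2 * (f s)\<^sup>2 + 2 * (h i s)\<^sup>2"
        by (simp add: power2_eq_square algebra_simps)
      ultimately show "norm ((f s - h i s)\<^sup>2) \<le> 2 * (f s)\<^sup>2 + 2 * (w s)\<^sup>2" by simp
    qed
  qed simp_all
  then have "\<forall>\<^sub>F i in sequentially. (LINT s|sphere2. (f s - h i s)\<^sup>2) < e"
    using \<open>e > 0\<close> by (intro order_tendstoD(2)) auto
  then obtain i where "(LINT s|sphere2. (f s - h i s)\<^sup>2) < e"
    by (auto simp: eventually_sequentially)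
  then show "\<exists>h. poly_approx h \<and> ip (\<lambda>s. f s - h s) (\<lambda>s. f s - h s) < e"
    using h by (auto simp: ip_self)
qed

text \<open>
The continuous functions \<open>max 0 (1 - i dist(s, K))\<close> decrease to the indicator of \<open>K\<close>.
\<close>

lemma poly_approx_indicator_compact:
  assumes K: "compact K"
  shows "poly_approx (indicator K)"
proof (cases "K = {}")
  case False
  define h where "h i s = max 0 (1 - real i * infdist s K)" for i s
  have K': "closed K" using K by (rule compact_imp_closed)
  show ?thesis
  proof (rule poly_approx_dominated[where h = h and w = "\<lambda>_. 1"])
    have "(indicator K :: _ \<Rightarrow> real) \<in> borel_measurable sphere2"
      unfolding measurable_cong_sets[OF sets_sphere2 refl] using K'
      by (intro measurable_restrict_space1 borel_measurable_indicator borel_closed)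
    then show "(indicator K :: _ \<Rightarrow> real) \<in> sphere_L2"
      by (rule sphere_L2_bounded[where B = 1]) (auto simp: indicator_def)
    show "poly_approx (h i)" for i
      unfolding h_def by (intro poly_approx_continuous continuous_intros)
    show "\<bar>h i s\<bar> \<le> 1" for i s
      by (simp add: h_def infdist_nonneg)
    show "(\<lambda>i. h i s) \<longlonglongrightarrow> indicator K s" for s
    proof (cases "s \<in> K")
      case True
      then show ?thesis by (simp add: h_def)
    next
      case s: False
      then have pos: "infdist s K > 0"
        using in_closed_iff_infdist_zero[OF K' False] infdist_nonneg[of s K] by (simp add: less_le)
      obtain N where N: "1 / infdist s K < real N" using reals_Archimedean2 by blast
      have "h i s = 0" if "i \<ge> N" for i
      proof -
        have "1 < real N * infdist s K" using N pos by (simp add: field_simps)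
        also have "\<dots> \<le> real i * infdist s K" using that pos by (intro mult_right_mono) auto
        finally show ?thesis by (simp add: h_def)
      qed
      then have "\<forall>\<^sub>F i in sequentially. h i s = 0" by (auto simp: eventually_sequentially)
      then show ?thesis using s by (simp add: tendsto_eventually)
    qed
  qed (rule sphere_L2_const)
qed (simp add: poly_approx_continuous)

text \<open>
By inner regularity a measurable set is exhausted by compact subsets up to small measure.
\<close>

lemma poly_approx_indicator:
  assumes A: "A \<in> sets sphere2"
  shows "poly_approx (indicator A)"
proof (rule poly_approx_closed)
  have m: "(indicator A :: _ \<Rightarrow> real) \<in> borel_measurable sphere2" using A by simp
  then show "(indicator A :: _ \<Rightarrow> real) \<in> sphere_L2"
    by (rule sphere_L2_bounded[where B = 1]) (auto simp: indicator_def)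
  fix e :: real assume e: "e > 0"
  define M where "M = distr sphere2 borel (\<lambda>x. x)"
  have id: "(\<lambda>x. x) \<in> sphere2 \<rightarrow>\<^sub>M borel"
    by (rule borel_measurable_sphere2_continuous) (rule continuous_on_id)
  have A': "A \<in> sets borel" "A \<subseteq> sphere 0 1"
    using A by (auto simp: sets_sphere2 sets_restrict_space_iff)
  have eM: "emeasure M B = emeasure sphere2 (B \<inter> sphere 0 1)" if "B \<in> sets borel" for B
    using that id by (simp add: M_def emeasure_distr)
  have sup: "emeasure M A = (SUP K\<in>{K. K \<subseteq> A \<and> compact K}. emeasure M K)"
    by (rule inner_regular) (auto simp: M_def A' emeasure_distr[OF id])
  have ne: "{K. K \<subseteq> A \<and> compact K} \<noteq> {}" using compact_empty by blast
  have fin: "emeasure M A \<noteq> \<infinity>" by (simp add: eM[OF A'(1)])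
  obtain K where K: "K \<subseteq> A" "compact K" "emeasure M A < emeasure M K + e"
    using SUP_approx_ennreal[OF e ne sup fin] by auto
  have Kb: "K \<in> sets borel" using K(2) by (simp add: compact_imp_closed)
  have Ks: "K \<in> sets sphere2" using K A' Kb by (auto simp: sets_sphere2 sets_restrict_space_iff)
  have i: "B \<inter> sphere 0 1 = B" if "B \<subseteq> A" for B using that A' by auto
  have "ennreal (measure sphere2 A) < ennreal (measure sphere2 K) + ennreal e"
    using K(3) by (simp add: eM A' Kb i K sphere2.emeasure_eq_measure del: ennreal_plus)
  then have "measure sphere2 A < measure sphere2 K + e"
    using e by (simp add: ennreal_less_iff flip: ennreal_plus)
  moreover have "ip (\<lambda>s. indicator A s - indicator K s) (\<lambda>s. indicator A s - indicator K s) = measure sphere2 (A - K)"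
  proof -
    have "ip (\<lambda>s. indicator A s - indicator K s) (\<lambda>s. indicator A s - indicator K s) = (LINT s|sphere2. indicator (A - K) s)"
      unfolding ip_def using K(1) by (intro Bochner_Integration.integral_cong) (auto simp: indicator_def)
    also have "\<dots> = measure sphere2 ((A - K) \<inter> space sphere2)"
      by (rule Bochner_Integration.integral_indicator)
    also have "(A - K) \<inter> space sphere2 = A - K" using A'(2) by auto
    finally show ?thesis .
  qed
  moreover have "measure sphere2 (A - K) = measure sphere2 A - measure sphere2 K"
    by (rule sphere2.finite_measure_Diff[OF A Ks K(1)])
  ultimately show "\<exists>h. poly_approx h \<and> ip (\<lambda>s. indicator A s - h s) (\<lambda>s. indicator A s - h s) < e"
    using poly_approx_indicator_compact[OF K(2)] by (intro exI[of _ "indicator K"]) auto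
qed

text \<open>
Simple functions converge to \<open>f\<close> pointwise with a bound by \<open>2 |f|\<close>.
\<close>

lemma poly_approx_sphere_L2:
  assumes f: "f \<in> sphere_L2"
  shows "poly_approx f"
proof -
  have fm: "f \<in> borel_measurable sphere2" using f by (simp add: sphere_L2_iff)
  from borel_measurable_implies_sequence_metric[OF fm, of 0]
  obtain h where "(\<forall>i. simple_function sphere2 (h i)) \<and> (\<forall>s\<in>sphere 0 1. (\<lambda>i. h i s) \<longlonglongrightarrow> f s) \<and>
      (\<forall>i. \<forall>s\<in>sphere 0 1. \<bar>h i s\<bar> \<le> 2 * \<bar>f s\<bar>)"
    by auto
  then have h: "\<And>i. simple_function sphere2 (h i)"
    "\<And>s. s \<in> sphere 0 1 \<Longrightarrow> (\<lambda>i. h i s) \<longlonglongrightarrow> f s"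
    "\<And>i s. s \<in> sphere 0 1 \<Longrightarrow> \<bar>h i s\<bar> \<le> 2 * \<bar>f s\<bar>"
    by blast+
  define h' where "h' i s = (\<Sum>y\<in>h i ` space sphere2. y * indicator (h i -` {y} \<inter> space sphere2) s)" for i s
  have h': "h' i s = h i s" if "s \<in> sphere 0 1" for i s
  proof -
    have fin: "finite (h i ` space sphere2)" using h(1) by (rule simple_functionD)
    have "h' i s = (\<Sum>y\<in>h i ` space sphere2. if y = h i s then y else 0)"
      unfolding h'_def using that by (intro sum.cong) (auto simp: indicator_def)
    also have "\<dots> = h i s" using fin that by (simp add: sum.delta)
    finally show ?thesis .
  qed
  show ?thesis
  proof (rule poly_approx_dominated[OF f, where h = h' and w = "\<lambda>s. 2 * \<bar>f s\<bar>"])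
    show "(\<lambda>s. 2 * \<bar>f s\<bar>) \<in> sphere_L2" using f by (auto simp: sphere_L2_iff power_mult_distrib)
    show "poly_approx (h' i)" for i
      unfolding h'_def using h(1)
      by (intro poly_approx_sum poly_approx_scale poly_approx_indicator simple_functionD)
  qed (use h h' in auto)
qed

section \<open>Monomials spanning the polynomials on the sphere\<close>

definition mono3 :: "nat \<Rightarrow> nat \<Rightarrow> nat \<Rightarrow> real^3 \<Rightarrow> real" where
  "mono3 a b c x = (x $ 1) ^ a * (x $ 2) ^ b * (x $ 3) ^ c"

text \<open>
An enumeration of the monomials at most linear in the third coordinate, by degree: the \<open>2 n + 1\<close>
indices from \<open>n\<^sup>2\<close> to \<open>(n + 1)\<^sup>2 - 1\<close> carry degree \<open>n\<close>, first the \<open>n + 1\<close> monomials free of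
the third coordinate and then the \<open>n\<close> others.
\<close>

definition sphere_monomial :: "nat \<Rightarrow> real^3 \<Rightarrow> real" where
  "sphere_monomial k =
     (let n = floor_sqrt k; j = k - n\<^sup>2
      in if j \<le> n then mono3 j (n - j) 0 else mono3 (j - n - 1) (2 * n - j) 1)"

lemma deg_less_mono3: "deg_less (Suc (a + b + c)) (mono3 a b c)"
proof -
  have "deg_less (a + (b + Suc c))
      (\<lambda>x. (axis 1 1 \<bullet> x) ^ a * ((axis 2 1 \<bullet> x) ^ b * (axis 3 1 \<bullet> x) ^ c))"
    by (intro deg_less_linear_power deg_less_power)
  then show ?thesis by (simp add: mono3_def[abs_def] inner_axis' mult.assoc add.assoc)
qed

lemma sphere_monomial_cases:
  obtains a b c where "c \<le> 1" "a + b + c = floor_sqrt k" "sphere_monomial k = mono3 a b c"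
proof -
  define n where "n = floor_sqrt k"
  define j where "j = k - n\<^sup>2"
  have "k < (Suc n)\<^sup>2" using Suc_floor_sqrt_power2_gt[of k] by (simp add: n_def)
  then have j: "j \<le> 2 * n" by (simp add: j_def power2_eq_square)
  have s: "sphere_monomial k = (if j \<le> n then mono3 j (n - j) 0 else mono3 (j - n - 1) (2 * n - j) 1)"
    by (simp add: sphere_monomial_def n_def j_def Let_def)
  show thesis
  proof (cases "j \<le> n")
    case True
    then show thesis using that[of 0 j "n - j"] s by (simp add: n_def)
  next
    case False
    then show thesis using that[of 1 "j - n - 1" "2 * n - j"] s j by (simp add: n_def)
  qed
qed

lemma deg_less_sphere_monomial: "deg_less (Suc (floor_sqrt k)) (sphere_monomial k)"
  by (metis sphere_monomial_cases deg_less_mono3)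

lemma mono3_eq_sphere_monomial:
  assumes "c \<le> 1"
  obtains k where "k < (Suc (a + b + c))\<^sup>2" "sphere_monomial k = mono3 a b c"
proof -
  define n where "n = a + b + c"
  define j where "j = (if c = 0 then a else Suc (n + a))"
  have j: "j \<le> 2 * n" using assms by (auto simp: j_def n_def)
  have less: "n\<^sup>2 + j < (Suc n)\<^sup>2" using j by (simp add: power2_eq_square)
  have sq: "floor_sqrt (n\<^sup>2 + j) = n" using less by (intro floor_sqrt_unique) auto
  have "sphere_monomial (n\<^sup>2 + j) = mono3 a b c"
    unfolding sphere_monomial_def sq Let_def using assms by (auto simp: j_def n_def le_Suc_eq)
  then show thesis using that less by (simp add: n_def)
qed

text \<open>
Equality is asked on the sphere only, where squares of the third coordinate can be eliminated.
\<close>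

definition on_span :: "nat \<Rightarrow> (real^3 \<Rightarrow> real) \<Rightarrow> bool" where
  "on_span K f \<longleftrightarrow> (\<exists>a. \<forall>s\<in>sphere 0 1. f s = (\<Sum>k<K. a k * sphere_monomial k s))"

lemma on_span_add:
  assumes "on_span K f" "on_span K g"
  shows "on_span K (\<lambda>s. f s + g s)"
proof -
  from assms obtain a b where "\<forall>s\<in>sphere 0 1. f s = (\<Sum>k<K. a k * sphere_monomial k s)"
    "\<forall>s\<in>sphere 0 1. g s = (\<Sum>k<K. b k * sphere_monomial k s)" unfolding on_span_def by blast
  then show ?thesis unfolding on_span_def
    by (intro exI[of _ "\<lambda>k. a k + b k"]) (auto simp: sum.distrib distrib_right)
qed

lemma on_span_scale:
  assumes "on_span K f"
  shows "on_span K (\<lambda>s. c * f s)"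
proof -
  from assms obtain a where "\<forall>s\<in>sphere 0 1. f s = (\<Sum>k<K. a k * sphere_monomial k s)"
    unfolding on_span_def by blast
  then show ?thesis unfolding on_span_def
    by (intro exI[of _ "\<lambda>k. c * a k"]) (auto simp: sum_distrib_left mult.assoc)
qed

lemma on_span_cong: "on_span K f \<Longrightarrow> (\<And>s. s \<in> sphere 0 1 \<Longrightarrow> g s = f s) \<Longrightarrow> on_span K g"
  unfolding on_span_def by auto

lemma on_span_zero: "on_span K (\<lambda>s. 0)"
  unfolding on_span_def by (intro exI[of _ "\<lambda>_. 0"]) auto

lemma on_span_sum: "(\<And>i. i \<in> I \<Longrightarrow> on_span K (f i)) \<Longrightarrow> on_span K (\<lambda>s. \<Sum>i\<in>I. f i s)"
  by (induction I rule: infinite_finite_induct) (auto intro: on_span_add on_span_zero)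

lemma on_span_sphere_monomial: "k < K \<Longrightarrow> on_span K (sphere_monomial k)"
  unfolding on_span_def
  by (intro exI[of _ "\<lambda>i. if i = k then 1 else 0"]) (simp add: if_distrib[of "\<lambda>x. x * _"] cong: if_cong)

lemma on_span_mono3:
  assumes "c \<le> 1" "a + b + c < n"
  shows "on_span (n\<^sup>2) (mono3 a b c)"
proof -
  obtain k where k: "k < (Suc (a + b + c))\<^sup>2" "sphere_monomial k = mono3 a b c"
    using mono3_eq_sphere_monomial[OF assms(1)] .
  have "(Suc (a + b + c))\<^sup>2 \<le> n\<^sup>2" using assms(2) by (intro power_mono) auto
  then show ?thesis using k on_span_sphere_monomial[OF less_le_trans[of k _ "n\<^sup>2"]] by metis
qed

lemma sphere_coordinates: "s \<in> sphere 0 1 \<Longrightarrow> (s $ 3)\<^sup>2 = 1 - (s $ 1)\<^sup>2 - (s $ 2)\<^sup>2" for s :: "real^3"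
  using dot_square_norm[of s] by (simp add: inner_vec_def sum_3 power2_eq_square)

text \<open>
Multiplication of a reduced monomial by the third coordinate can produce its square, which the
equation of the sphere replaces without raising the degree.
\<close>

lemma on_span_mono3_reduce:
  assumes c: "c \<le> 2" and abc: "a + b + c < n"
  shows "on_span (n\<^sup>2) (mono3 a b c)"
proof (cases "c = 2")
  case True
  have "on_span (n\<^sup>2) (\<lambda>s. mono3 a b 0 s + (-1) * mono3 (a + 2) b 0 s + (-1) * mono3 a (b + 2) 0 s)"
    using abc True by (intro on_span_add on_span_scale on_span_mono3) auto
  then show ?thesis
  proof (rule on_span_cong)
    fix s :: "real^3" assume "s \<in> sphere 0 1"
    then show "mono3 a b c s = mono3 a b 0 s + (-1) * mono3 (a + 2) b 0 s + (-1) * mono3 a (b + 2) 0 s"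
      unfolding mono3_def True
      by (simp only: sphere_coordinates) (simp add: power_add power2_eq_square algebra_simps)
  qed
qed (use assms in \<open>auto intro: on_span_mono3\<close>)

lemma on_span_coordinate_mult:
  fixes i :: 3
  assumes "on_span (n\<^sup>2) f"
  shows "on_span ((Suc n)\<^sup>2) (\<lambda>s. s $ i * f s)"
proof -
  obtain a where a: "\<forall>s\<in>sphere 0 1. f s = (\<Sum>k<n\<^sup>2. a k * sphere_monomial k s)"
    using assms unfolding on_span_def by blast
  have "on_span ((Suc n)\<^sup>2) (\<lambda>s. s $ i * sphere_monomial k s)" if k: "k < n\<^sup>2" for k
  proof -
    obtain p q r where pqr: "r \<le> 1" "p + q + r = floor_sqrt k" "sphere_monomial k = mono3 p q r"
      by (rule sphere_monomial_cases)
    have "floor_sqrt k < n" using k by (metis le_floor_sqrt_iff not_le)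
    then have "on_span ((Suc n)\<^sup>2) (mono3 (Suc p) q r)" "on_span ((Suc n)\<^sup>2) (mono3 p (Suc q) r)"
      "on_span ((Suc n)\<^sup>2) (mono3 p q (Suc r))"
      using pqr by (auto intro!: on_span_mono3_reduce)
    moreover have "(\<lambda>s. s $ 1 * mono3 p q r s) = mono3 (Suc p) q r"
      "(\<lambda>s. s $ 2 * mono3 p q r s) = mono3 p (Suc q) r" "(\<lambda>s. s $ 3 * mono3 p q r s) = mono3 p q (Suc r)"
      by (auto simp: mono3_def fun_eq_iff)
    ultimately show ?thesis using exhaust_3[of i] pqr(3) by auto
  qed
  then have "on_span ((Suc n)\<^sup>2) (\<lambda>s. \<Sum>k<n\<^sup>2. a k * (s $ i * sphere_monomial k s))"
    by (intro on_span_sum on_span_scale) auto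
  then show ?thesis
    by (rule on_span_cong) (simp add: a sum_distrib_left mult.left_commute)
qed

text \<open>
The restrictions of polynomials of degree less than \<open>n\<close> are spanned by \<open>n\<^sup>2\<close> functions. This is the
upper half of the classical dimension formula.
\<close>

lemma deg_less_on_span: "deg_less n f \<Longrightarrow> on_span (n\<^sup>2) f"
proof (induction rule: deg_less.induct)
  case (const n c)
  have "on_span ((Suc n)\<^sup>2) (\<lambda>s. c * mono3 0 0 0 s)"
    by (intro on_span_scale on_span_mono3) auto
  then show ?case by (simp add: mono3_def)
next
  case (linear n f v)
  have "on_span ((Suc n)\<^sup>2) (\<lambda>s. \<Sum>i\<in>UNIV. v $ i * (s $ i * f s))"
    by (intro on_span_sum on_span_scale on_span_coordinate_mult linear.IH)
  then show ?case by (simp add: inner_vec_def sum_distrib_right mult.assoc)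
qed (auto intro: on_span_zero on_span_add)

section \<open>Orthonormal systems\<close>

text \<open>
Zero functions are admitted: Gram-Schmidt then applies to any sequence, without a discussion of linear
independence, and sums over the system are not affected.
\<close>

definition orthosystem :: "'i set \<Rightarrow> ('i \<Rightarrow> real^3 \<Rightarrow> real) \<Rightarrow> bool" where
  "orthosystem I e \<longleftrightarrow> finite I \<and> (\<forall>i\<in>I. e i \<in> sphere_L2) \<and>
     (\<forall>i\<in>I. \<forall>j\<in>I. i \<noteq> j \<longrightarrow> ip (e i) (e j) = 0) \<and> (\<forall>i\<in>I. ip (e i) (e i) = 1 \<or> e i = (\<lambda>x. 0))"

lemma ip_zero [simp]: "ip (\<lambda>x. 0) f = 0" "ip f (\<lambda>x. 0) = 0"
  by (simp_all add: ip_def)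

lemma orthosystem_L2: "orthosystem I e \<Longrightarrow> (\<lambda>s. \<Sum>i\<in>I. a i * e i s) \<in> sphere_L2"
  by (intro sphere_L2_sum sphere_L2_scale) (auto simp: orthosystem_def)

lemma ip_orthosystem:
  assumes e: "orthosystem I e" and j: "j \<in> I"
  shows "ip (\<lambda>s. \<Sum>i\<in>I. a i * e i s) (e j) = a j * ip (e j) (e j)"
proof -
  have "ip (\<lambda>s. \<Sum>i\<in>I. a i * e i s) (e j) = (\<Sum>i\<in>I. a i * ip (e i) (e j))"
    using e j by (subst ip_sum_left) (auto simp: orthosystem_def ip_scale_left intro: sphere_L2_scale)
  also have "\<dots> = (\<Sum>i\<in>I. if i = j then a j * ip (e j) (e j) else 0)"
    using e j by (intro sum.cong) (auto simp: orthosystem_def)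
  finally show ?thesis using e j by (simp add: orthosystem_def)
qed

lemma ip_orthosystem_right:
  assumes e: "orthosystem I e" and h: "h \<in> sphere_L2"
  shows "ip h (\<lambda>s. \<Sum>i\<in>I. a i * e i s) = (\<Sum>i\<in>I. a i * ip h (e i))"
  using e h by (subst ip_sum_right) (auto simp: orthosystem_def ip_scale_right intro: sphere_L2_scale)

lemma ip_orthosystem_self:
  assumes e: "orthosystem I e"
  shows "ip (\<lambda>s. \<Sum>i\<in>I. a i * e i s) (\<lambda>s. \<Sum>i\<in>I. b i * e i s) = (\<Sum>i\<in>I. a i * b i * ip (e i) (e i))"
  unfolding ip_orthosystem_right[OF e orthosystem_L2[OF e]]
  by (intro sum.cong) (auto simp: ip_orthosystem[OF e])

text \<open>
Pythagoras' theorem for the projection to the span of the system. A zero member contributes nothing to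
either side.
\<close>

lemma orthosystem_residual:
  assumes e: "orthosystem I e" and h: "h \<in> sphere_L2"
  shows "ip (\<lambda>s. h s - (\<Sum>i\<in>I. ip h (e i) * e i s)) (\<lambda>s. h s - (\<Sum>i\<in>I. ip h (e i) * e i s))
    = ip h h - (\<Sum>i\<in>I. (ip h (e i))\<^sup>2)"
proof -
  have "(\<Sum>i\<in>I. ip h (e i) * ip h (e i) * ip (e i) (e i)) = (\<Sum>i\<in>I. ip h (e i) * ip h (e i))"
    using e by (intro sum.cong) (auto simp: orthosystem_def)
  then show ?thesis
    by (simp add: ip_diff_self[OF h orthosystem_L2[OF e]] ip_orthosystem_self[OF e]
        ip_orthosystem_right[OF e h] power2_eq_square)
qed

lemma orthosystem_bessel:
  assumes e: "orthosystem I e" and h: "h \<in> sphere_L2"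
  shows "(\<Sum>i\<in>I. (ip h (e i))\<^sup>2) \<le> ip h h"
  using orthosystem_residual[OF assms] ip_nonneg[of "\<lambda>s. h s - (\<Sum>i\<in>I. ip h (e i) * e i s)"] by linarith

section \<open>Spherical harmonics\<close>

text \<open>
The Gram-Schmidt process on the monomials in order of degree. A vector in the span of its predecessors
gives the zero function.
\<close>

function harmonic :: "nat \<Rightarrow> real^3 \<Rightarrow> real" where
  "harmonic k =
     (let h = (\<lambda>x. sphere_monomial k x - (\<Sum>i<k. ip (sphere_monomial k) (harmonic i) * harmonic i x))
      in if ip h h = 0 then (\<lambda>x. 0) else (\<lambda>x. inverse (sqrt (ip h h)) * h x))"
  by pat_completeness auto
termination by (relation "Wellfounded.measure id") auto

declare harmonic.simps [simp del]

lemma deg_less_harmonic: "deg_less (Suc (floor_sqrt k)) (harmonic k)"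
proof (induction k rule: less_induct)
  case (less k)
  define h where "h x = sphere_monomial k x - (\<Sum>i<k. ip (sphere_monomial k) (harmonic i) * harmonic i x)" for x
  have "deg_less (Suc (floor_sqrt k)) (harmonic i)" if "i < k" for i
    using deg_less_mono[OF less.IH[OF that]] mono_floor_sqrt'[of i k] that by auto
  then have "deg_less (Suc (floor_sqrt k)) h"
    unfolding h_def[abs_def]
    by (intro deg_less_diff deg_less_sum deg_less_scale deg_less_sphere_monomial) auto
  moreover have "harmonic k = (if ip h h = 0 then (\<lambda>x. 0) else (\<lambda>x. inverse (sqrt (ip h h)) * h x))"
    by (simp add: harmonic.simps[of k] h_def[abs_def] Let_def)
  ultimately show ?case by (auto intro: deg_less.zero deg_less_scale)
qed

lemma harmonic_L2: "harmonic k \<in> sphere_L2"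
  by (rule sphere_L2_deg_less[OF deg_less_harmonic])

text \<open>
One Gram-Schmidt step. If the projected vector \<open>h\<close> has norm zero it vanishes on the sphere because it is
continuous; in both cases the monomial is recovered there as a combination of the harmonics.
\<close>

lemma harmonic_step:
  assumes e: "orthosystem {..<k} harmonic"
  shows "orthosystem {..<Suc k} harmonic"
    and "\<exists>a. \<forall>s\<in>sphere 0 1. sphere_monomial k s = (\<Sum>i<Suc k. a i * harmonic i s)"
proof -
  define c where "c i = ip (sphere_monomial k) (harmonic i)" for i
  define h where "h x = sphere_monomial k x - (\<Sum>i<k. c i * harmonic i x)" for x
  have m: "sphere_monomial k \<in> sphere_L2" by (rule sphere_L2_deg_less[OF deg_less_sphere_monomial])
  have h: "deg_less (Suc (floor_sqrt k)) h"
    unfolding h_def[abs_def]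
    by (intro deg_less_diff deg_less_sum deg_less_scale deg_less_sphere_monomial
          deg_less_mono[OF deg_less_harmonic]) (auto intro: mono_floor_sqrt')
  have hk: "harmonic k = (if ip h h = 0 then (\<lambda>x. 0) else (\<lambda>x. inverse (sqrt (ip h h)) * h x))"
    by (simp add: harmonic.simps[of k] h_def[abs_def] c_def Let_def)
  have "ip h (harmonic i) = 0" if "i < k" for i
  proof -
    have "ip h (harmonic i) = c i - c i * ip (harmonic i) (harmonic i)"
      unfolding h_def[abs_def] using that
      by (simp add: ip_diff_left[OF m orthosystem_L2[OF e] harmonic_L2] ip_orthosystem[OF e] flip: c_def)
    moreover have "ip (harmonic i) (harmonic i) = 1 \<or> c i = 0"
      using e that by (auto simp: orthosystem_def c_def)
    ultimately show ?thesis by auto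
  qed
  then have o1: "ip (harmonic k) (harmonic i) = 0" if "i < k" for i
    using that by (simp add: hk ip_scale_left)
  have o2: "ip (harmonic i) (harmonic k) = 0" if "i < k" for i
    using o1[OF that] by (subst ip_commute)
  have "ip (harmonic k) (harmonic k) = 1 \<or> harmonic k = (\<lambda>x. 0)"
  proof (cases "ip h h = 0")
    case False
    then have "ip (harmonic k) (harmonic k) = inverse (sqrt (ip h h)) * (inverse (sqrt (ip h h)) * ip h h)"
      by (simp only: hk if_False ip_scale_left ip_scale_right)
    also have "\<dots> = ip h h / (sqrt (ip h h) * sqrt (ip h h))" by (simp add: field_simps)
    also have "\<dots> = 1" using ip_nonneg[of h] False by simp
    finally show ?thesis ..
  qed (simp add: hk)
  then show "orthosystem {..<Suc k} harmonic"
    using e o1 o2 unfolding orthosystem_def by (auto simp: harmonic_L2 less_Suc_eq)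
  show "\<exists>a. \<forall>s\<in>sphere 0 1. sphere_monomial k s = (\<Sum>i<Suc k. a i * harmonic i s)"
  proof (intro exI ballI)
    fix s :: "real^3" assume s: "s \<in> sphere 0 1"
    have "h s = sqrt (ip h h) * harmonic k s"
    proof (cases "ip h h = 0")
      case True
      then show ?thesis using ip_self_eq_0[OF deg_less_continuous_on[OF h] _ s] by (simp only: hk) simp
    next
      case False
      then have "harmonic k s = inverse (sqrt (ip h h)) * h s" by (simp only: hk if_False)
      then show ?thesis using False by simp
    qed
    moreover have "(\<Sum>i<k. (if i = k then sqrt (ip h h) else c i) * harmonic i s) = (\<Sum>i<k. c i * harmonic i s)"
      by (intro sum.cong) auto
    ultimately show "sphere_monomial k s = (\<Sum>i<Suc k. (if i = k then sqrt (ip h h) else c i) * harmonic i s)"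
      by (simp add: h_def)
  qed
qed

lemma orthosystem_harmonic_lessThan: "orthosystem {..<k} harmonic"
proof (induction k)
  case 0
  show ?case by (simp add: orthosystem_def)
qed (rule harmonic_step)

lemma orthosystem_subset: "orthosystem I e \<Longrightarrow> J \<subseteq> I \<Longrightarrow> orthosystem J e"
  unfolding orthosystem_def by (meson finite_subset subset_iff)

lemma orthosystem_harmonic:
  assumes "finite I" shows "orthosystem I harmonic"
proof -
  obtain K where "I \<subseteq> {..<K}" using assms finite_nat_bounded by blast
  then show ?thesis using orthosystem_subset[OF orthosystem_harmonic_lessThan] by blast
qed

lemma harmonic_norm_le: "ip (harmonic k) (harmonic k) \<le> 1"
  using orthosystem_harmonic[of "{k}"] by (auto simp: orthosystem_def)

text \<open>
Either the squared norm is 1 or the function is zero; in products with values of the function the norm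
can therefore be dropped.
\<close>

lemma harmonic_norm_mult: "ip (harmonic k) (harmonic k) * harmonic k s = harmonic k s"
  using orthosystem_harmonic[of "{k}"] by (auto simp: orthosystem_def)

text \<open>
Some expansion in harmonics exists by the spanning property of the monomials; orthogonality identifies
its coefficients, except those of zero members, which do not matter.
\<close>

lemma harmonic_square:
  "harmonic k s * harmonic k s * ip (harmonic k) (harmonic k) = (harmonic k s)\<^sup>2"
  using harmonic_norm_mult[of k s] by (simp add: power2_eq_square mult.assoc mult.commute[of _ "ip _ _"])

lemma harmonic_reproducing:
  assumes f: "deg_less n f" and s: "s \<in> sphere 0 1"
  shows "f s = (\<Sum>k<n\<^sup>2. ip f (harmonic k) * harmonic k s)"
proof -
  obtain a where a: "\<And>s. s \<in> sphere 0 1 \<Longrightarrow> f s = (\<Sum>k<n\<^sup>2. a k * sphere_monomial k s)"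
    using deg_less_on_span[OF f] unfolding on_span_def by blast
  have "\<forall>k. \<exists>b. \<forall>s\<in>sphere 0 1. sphere_monomial k s = (\<Sum>i<Suc k. b i * harmonic i s)"
    using harmonic_step(2)[OF orthosystem_harmonic_lessThan] by blast
  then obtain b where b: "\<And>k s. s \<in> sphere 0 1 \<Longrightarrow> sphere_monomial k s = (\<Sum>i<Suc k. b k i * harmonic i s)"
    by metis
  define d where "d i = (\<Sum>k<n\<^sup>2. a k * (if i \<le> k then b k i else 0))" for i
  have d: "f s = (\<Sum>i<n\<^sup>2. d i * harmonic i s)" if s: "s \<in> sphere 0 1" for s
  proof -
    have "f s = (\<Sum>k<n\<^sup>2. a k * (\<Sum>i<n\<^sup>2. (if i \<le> k then b k i else 0) * harmonic i s))"
      unfolding a[OF s]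
    proof (intro sum.cong refl, unfold b[OF s])
      fix k assume "k \<in> {..<n\<^sup>2}"
      then have "(\<Sum>i<Suc k. b k i * harmonic i s) = (\<Sum>i<n\<^sup>2. (if i \<le> k then b k i else 0) * harmonic i s)"
        by (intro sum.mono_neutral_cong_left) auto
      then show "a k * (\<Sum>i<Suc k. b k i * harmonic i s)
          = a k * (\<Sum>i<n\<^sup>2. (if i \<le> k then b k i else 0) * harmonic i s)" by simp
    qed
    also have "\<dots> = (\<Sum>i<n\<^sup>2. d i * harmonic i s)"
      unfolding d_def sum_distrib_left sum_distrib_right
      by (subst sum.swap) (simp add: mult.assoc)
    finally show ?thesis .
  qed
  have "ip f (harmonic k) * harmonic k s = d k * harmonic k s" if k: "k < n\<^sup>2" for k
  proof -
    have "ip f (harmonic k) = ip (\<lambda>s. \<Sum>i<n\<^sup>2. d i * harmonic i s) (harmonic k)"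
      by (rule ip_cong) (auto simp: d)
    also have "\<dots> = d k * ip (harmonic k) (harmonic k)"
      using k by (intro ip_orthosystem orthosystem_harmonic) auto
    finally show ?thesis by (simp add: mult.assoc harmonic_norm_mult)
  qed
  then show ?thesis unfolding d[OF s] by (intro sum.cong refl) (simp only: lessThan_iff)
qed

lemma ip_harmonic_lower:
  assumes f: "deg_less n f" and k: "n\<^sup>2 \<le> k"
  shows "ip f (harmonic k) = 0"
proof -
  have "ip f (harmonic k) = ip (\<lambda>s. \<Sum>i<n\<^sup>2. ip f (harmonic i) * harmonic i s) (harmonic k)"
    by (rule ip_cong) (auto simp: harmonic_reproducing[OF f])
  also have "\<dots> = (\<Sum>i<n\<^sup>2. ip f (harmonic i) * ip (harmonic i) (harmonic k))"
    by (simp add: ip_sum_left sphere_L2_scale harmonic_L2 ip_scale_left)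
  also have "\<dots> = 0"
    using orthosystem_harmonic[of "{..k}"] k by (intro sum.neutral) (auto simp: orthosystem_def)
  finally show ?thesis .
qed

section \<open>Eigenvalues of the Laplace operator\<close>

definition eigenvalue :: "nat \<Rightarrow> real" where
  "eigenvalue n = real n * (real n + 1)"

text \<open>
Let \<open>m\<close> be the degree of the harmonic. The remainder \<open>r\<close> in the leading-term formula has lower degree,
so it is orthogonal to the harmonic. It is also orthogonal to its Laplacian, because the Laplacian is
symmetric and maps \<open>r\<close> to a polynomial of lower degree. Hence \<open>r\<close> is orthogonal to itself and vanishes.
\<close>

lemma lap_harmonic:
  assumes s: "s \<in> sphere 0 1"
  shows "lap (harmonic k) s = - eigenvalue (floor_sqrt k) * harmonic k s"
proof -
  define m where "m = floor_sqrt k"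
  have e: "deg_less (Suc m) (harmonic k)" using deg_less_harmonic by (simp add: m_def)
  obtain r where r: "deg_less m r"
    "\<And>x. x \<in> sphere 0 1 \<Longrightarrow> lap (harmonic k) x = - eigenvalue m * harmonic k x + r x"
    using lap_leading[OF e] by (auto simp: eigenvalue_def mult.commute add.commute)
  have mk: "m\<^sup>2 \<le> k" by (simp add: m_def)
  have "ip r r = ip (\<lambda>x. lap (harmonic k) x - (- eigenvalue m) * harmonic k x) r"
    by (rule ip_cong) (auto simp: r)
  also have "\<dots> = ip (lap (harmonic k)) r - (- eigenvalue m) * ip (harmonic k) r"
    using ip_diff_left[OF sphere_L2_deg_less[OF deg_less_lap[OF e]]
        sphere_L2_scale[OF harmonic_L2] sphere_L2_deg_less[OF r(1)]]
    by (simp only: ip_scale_left)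
  also have "ip (lap (harmonic k)) r = 0"
    unfolding ip_lap[OF e r(1)] ip_commute[of "harmonic k"]
    by (rule ip_harmonic_lower[OF deg_less_lap[OF r(1)] mk])
  also have "ip (harmonic k) r = 0"
    unfolding ip_commute[of "harmonic k"] by (rule ip_harmonic_lower[OF r(1) mk])
  finally have "r s = 0"
    using ip_self_eq_0[OF deg_less_continuous_on[OF r(1)] _ s] by simp
  then show ?thesis using r(2)[OF s] by (simp add: m_def)
qed

section \<open>The reproducing kernel on the diagonal\<close>

text \<open>
The square root of the diagonal value at \<open>s\<close> is the norm of the evaluation at \<open>s\<close> on the polynomials of
degree less than \<open>n\<close>, a rotation invariant space. So test the evaluation at \<open>s\<close> with \<open>f \<circ> T\<close>, where \<open>f\<close>
is the reproducing kernel at \<open>T s\<close>.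
\<close>

lemma kernel_rotation_le:
  assumes T: "orthogonal_transformation T" and s: "s \<in> sphere 0 1"
  shows "(\<Sum>k<n\<^sup>2. (harmonic k (T s))\<^sup>2) \<le> (\<Sum>k<n\<^sup>2. (harmonic k s)\<^sup>2)"
proof -
  define A where "A = (\<Sum>k<n\<^sup>2. (harmonic k (T s))\<^sup>2)"
  define B where "B = (\<Sum>k<n\<^sup>2. (harmonic k s)\<^sup>2)"
  define f where "f x = (\<Sum>k<n\<^sup>2. harmonic k (T s) * harmonic k x)" for x
  have "deg_less n (harmonic k)" if "k < n\<^sup>2" for k
    using deg_less_mono[OF deg_less_harmonic[of k], of n] that
    by (metis Suc_leI le_floor_sqrt_iff not_le)
  then have f: "deg_less n f"
    unfolding f_def[abs_def] by (intro deg_less_sum deg_less_scale) auto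
  have g: "deg_less n (\<lambda>x. f (T x))"
    by (rule deg_less_compose_linear[OF orthogonal_transformation_linear[OF T] f])
  have ff: "ip f f = A"
    unfolding f_def[abs_def] ip_orthosystem_self[OF orthosystem_harmonic[OF finite_lessThan]] A_def
    by (intro sum.cong refl harmonic_square)
  have gg: "ip (\<lambda>x. f (T x)) (\<lambda>x. f (T x)) = A"
  proof -
    have "(\<lambda>x. f x * f x) \<in> borel_measurable sphere2"
      by (intro borel_measurable_sphere2_continuous continuous_on_mult deg_less_continuous_on[OF f])
    from integral_sphere2_orthogonal[OF T this] show ?thesis unfolding ff[symmetric] ip_def .
  qed
  have "A = f (T s)" by (simp add: A_def f_def power2_eq_square)
  also have "\<dots> = (\<Sum>k<n\<^sup>2. ip (\<lambda>x. f (T x)) (harmonic k) * harmonic k s)"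
    by (rule harmonic_reproducing[OF g s])
  finally have "A\<^sup>2 \<le> (\<Sum>k<n\<^sup>2. (ip (\<lambda>x. f (T x)) (harmonic k))\<^sup>2) * B"
    unfolding B_def by (simp add: Cauchy_Schwarz_ineq_sum)
  also have "\<dots> \<le> A * B"
    using orthosystem_bessel[OF orthosystem_harmonic[OF finite_lessThan] sphere_L2_deg_less[OF g], of "n\<^sup>2"]
    unfolding gg B_def by (intro mult_right_mono sum_nonneg) auto
  finally have "A * A \<le> A * B" by (simp add: power2_eq_square)
  moreover have "0 \<le> A" "0 \<le> B" by (auto simp: A_def B_def intro: sum_nonneg)
  ultimately have "A \<le> B" by (cases "A = 0") (auto simp: mult_le_cancel_left)
  then show ?thesis by (simp add: A_def B_def)
qed

lemma kernel_constant:
  assumes "s \<in> sphere 0 1" "t \<in> sphere 0 1"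
  shows "(\<Sum>k<n\<^sup>2. (harmonic k s)\<^sup>2) = (\<Sum>k<n\<^sup>2. (harmonic k t)\<^sup>2)"
proof (rule antisym)
  show "(\<Sum>k<n\<^sup>2. (harmonic k s)\<^sup>2) \<le> (\<Sum>k<n\<^sup>2. (harmonic k t)\<^sup>2)"
    using orthogonal_transformation_exists[of t s] kernel_rotation_le[of _ t n] assms by auto
  show "(\<Sum>k<n\<^sup>2. (harmonic k t)\<^sup>2) \<le> (\<Sum>k<n\<^sup>2. (harmonic k s)\<^sup>2)"
    using orthogonal_transformation_exists[of s t] kernel_rotation_le[of _ s n] assms by auto
qed

text \<open>
A constant function is determined by its integral, and the integral of \<open>e\<^sub>k\<^sup>2\<close> is at most 1. The sum
over \<open>1 \<le> k\<close> is constant as the difference of two kernels.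
\<close>

lemma kernel_diagonal_le:
  assumes s: "s \<in> sphere 0 1"
  shows "(\<Sum>k\<in>{1..<(Suc n)\<^sup>2}. (harmonic k s)\<^sup>2) \<le> ((real n + 1)\<^sup>2 - 1) / (4 * pi)"
proof -
  define A where "A t = (\<Sum>k\<in>{1..<(Suc n)\<^sup>2}. (harmonic k t)\<^sup>2)" for t
  have split: "(\<Sum>k<(Suc n)\<^sup>2. (harmonic k t)\<^sup>2) = (\<Sum>k<1\<^sup>2. (harmonic k t)\<^sup>2) + A t" for t
    using sum.atLeastLessThan_concat[of 0 1 "(Suc n)\<^sup>2" "\<lambda>k. (harmonic k t)\<^sup>2"]
    by (simp add: A_def lessThan_atLeast0)
  have A: "A t = A s" if "t \<in> sphere 0 1" for t
    using split[of s] split[of t] kernel_constant[OF s that, of "Suc n"] kernel_constant[OF s that, of 1] by simp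
  have "4 * pi * A s = (LINT t|sphere2. A s)"
    by (simp add: measure_sphere2_total)
  also have "\<dots> = (LINT t|sphere2. A t)"
    by (intro Bochner_Integration.integral_cong) (auto simp: A)
  also have "\<dots> = (\<Sum>k\<in>{1..<(Suc n)\<^sup>2}. ip (harmonic k) (harmonic k))"
    unfolding A_def ip_self using harmonic_L2
    by (intro Bochner_Integration.integral_sum) (auto simp: sphere_L2_iff)
  also have "\<dots> \<le> (\<Sum>k\<in>{1..<(Suc n)\<^sup>2}. 1)"
    by (intro sum_mono harmonic_norm_le)
  also have "\<dots> = (real n + 1)\<^sup>2 - 1"
    by (simp add: of_nat_diff power2_eq_square algebra_simps)
  finally show ?thesis by (simp add: A_def field_simps)
qed

lemma harmonic_0_const: "\<exists>c. harmonic 0 = (\<lambda>x. c)"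
  by (auto simp: harmonic.simps[of 0] Let_def sphere_monomial_def mono3_def[abs_def])

section \<open>Rotation fields as test fields\<close>

text \<open>
Vector fields with polynomial components. The class is closed under directional derivatives, which
makes its members smooth.
\<close>

definition poly_field :: "(real^3 \<Rightarrow> real^3) \<Rightarrow> bool" where
  "poly_field F \<longleftrightarrow> (\<forall>b. \<exists>n. deg_less n (\<lambda>x. F x \<bullet> b))"

lemma poly_field_differentiable:
  assumes "poly_field F"
  shows "F differentiable (at x)"
  using assms unfolding poly_field_def
  by (subst differentiable_componentwise_within)
    (meson deg_less_has_derivative differentiable_def)

lemma frechet_poly_field:
  assumes "poly_field F"
  shows "frechet_derivative F (at x) v \<bullet> b = frechet_derivative (\<lambda>x. F x \<bullet> b) (at x) v"
proof -
  have "(F has_derivative frechet_derivative F (at x)) (at x)"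
    using poly_field_differentiable[OF assms] frechet_derivative_works by blast
  then have "((\<lambda>x. F x \<bullet> b) has_derivative (\<lambda>v. frechet_derivative F (at x) v \<bullet> b)) (at x)"
    by (rule has_derivative_inner_left)
  from frechet_derivative_at[OF this] show ?thesis by metis
qed

lemma poly_field_frechet:
  assumes "poly_field F"
  shows "poly_field (\<lambda>x. frechet_derivative F (at x) v)"
  unfolding poly_field_def frechet_poly_field[OF assms]
  using assms deg_less_frechet unfolding poly_field_def by blast

lemma poly_field_Ck: "poly_field F \<Longrightarrow> Ck k F"
proof (induction k arbitrary: F)
  case 0
  have "continuous_on UNIV F"
    using poly_field_differentiable[OF 0]
    by (intro differentiable_imp_continuous_on) (simp add: differentiable_on_def)
  then show ?case by simp
next
  case (Suc k)
  then show ?case using poly_field_differentiable poly_field_frechet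
    by (simp add: differentiable_on_def)
qed

lemma bounded_linear_cross: "bounded_linear (cross3 w)"
  using bilinear_cross by (simp add: bilinear_def linear_conv_bounded_linear)

lemma rotation_field_smooth:
  assumes f: "deg_less n f"
  shows "smooth_tangent_field (\<lambda>x. f x *\<^sub>R cross3 w x)"
proof -
  have "deg_less (Suc n) (\<lambda>x. (f x *\<^sub>R cross3 w x) \<bullet> b)" for b
    using deg_less.linear[OF f, of "cross3 b w"] cross_triple'[of b w]
    by (simp add: inner_commute[of _ b] mult.commute)
  then have "poly_field (\<lambda>x. f x *\<^sub>R cross3 w x)" unfolding poly_field_def by blast
  then show ?thesis
    unfolding smooth_tangent_field_def by (auto simp: poly_field_Ck dot_cross_self)
qed

text \<open>
The rotation field \<open>w \<times> x\<close> is free of divergence and orthogonal to the normal \<open>s\<close>, so only the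
derivative of \<open>f\<close> along it remains.
\<close>

lemma sphere_div_rotation_field:
  assumes f: "deg_less n f"
  shows "sphere_div (\<lambda>x. f x *\<^sub>R cross3 w x) s = rot w f s"
proof -
  let ?D = "frechet_derivative f (at s)"
  have "((\<lambda>x. f x *\<^sub>R cross3 w x) has_derivative (\<lambda>h. f s *\<^sub>R cross3 w h + ?D h *\<^sub>R cross3 w s)) (at s)"
    by (intro has_derivative_scaleR deg_less_has_derivative[OF f]
        bounded_linear_imp_has_derivative[OF bounded_linear_cross])
  note D = fun_cong[OF frechet_derivative_at[OF this], symmetric]
  have "(\<Sum>b\<in>Basis. ?D b * (cross3 w s \<bullet> b)) = ?D (\<Sum>b\<in>Basis. (cross3 w s \<bullet> b) *\<^sub>R b)"
    unfolding linear_sum[OF linear_frechet[OF f]] linear_scale[OF linear_frechet[OF f]] real_scaleR_def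
    by (intro sum.cong refl mult.commute)
  also have "(\<Sum>b\<in>Basis. (cross3 w s \<bullet> b) *\<^sub>R b) = cross3 w s" by (rule euclidean_representation)
  finally show ?thesis
    by (simp add: sphere_div_def D inner_add_left dot_cross_self rot_def)
qed

section \<open>Energy and harmonic coefficients\<close>

text \<open>
The component of a vector field along the rotation field with axis \<open>w\<close>; for a gradient of \<open>u\<close> it is the
weak form of \<open>rot w u\<close>.
\<close>

definition rot_component :: "real^3 \<Rightarrow> (real^3 \<Rightarrow> real^3) \<Rightarrow> real^3 \<Rightarrow> real" where
  "rot_component w g s = g s \<bullet> cross3 w s"

lemma rot_component_L2:
  assumes g: "g \<in> sphere_L2" and w: "norm w = 1"
  shows "rot_component w g \<in> sphere_L2"
proof -
  have m: "rot_component w g \<in> borel_measurable sphere2"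
    unfolding rot_component_def[abs_def]
  proof (rule borel_measurable_inner)
    show "g \<in> borel_measurable sphere2" using g by (simp add: sphere_L2_def)
    show "cross3 w \<in> borel_measurable sphere2"
      by (intro borel_measurable_sphere2_continuous linear_continuous_on bounded_linear_cross)
  qed
  have "integrable sphere2 (\<lambda>s. (rot_component w g s)\<^sup>2)"
  proof (rule Bochner_Integration.integrable_bound)
    show "integrable sphere2 (\<lambda>s. (norm (g s))\<^sup>2)" using g by (simp add: sphere_L2_def)
    show "(\<lambda>s. (rot_component w g s)\<^sup>2) \<in> borel_measurable sphere2" using m by simp
    show "AE s in sphere2. norm ((rot_component w g s)\<^sup>2) \<le> norm ((norm (g s))\<^sup>2)"
    proof (rule AE_I2)
      fix s assume "s \<in> space sphere2"
      then have s: "s \<bullet> s = 1" and ww: "w \<bullet> w = 1" using w by (auto simp: dot_square_norm)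
      have "(norm (cross3 w s))\<^sup>2 = 1 - (w \<bullet> s)\<^sup>2"
        unfolding dot_square_norm[symmetric] dot_cross s ww by (simp add: power2_eq_square inner_commute)
      then have "(norm (cross3 w s))\<^sup>2 \<le> 1\<^sup>2" by simp
      then have 1: "norm (cross3 w s) \<le> 1" by (rule power2_le_imp_le) simp
      have "\<bar>rot_component w g s\<bar> \<le> norm (g s) * norm (cross3 w s)"
        unfolding rot_component_def by (rule Cauchy_Schwarz_ineq2)
      also have "\<dots> \<le> norm (g s)" using 1 by (simp add: mult_left_le)
      finally have "\<bar>rot_component w g s\<bar>\<^sup>2 \<le> (norm (g s))\<^sup>2" by (rule power_mono) simp
      then show "norm ((rot_component w g s)\<^sup>2) \<le> norm ((norm (g s))\<^sup>2)" by simp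
    qed
  qed
  then show ?thesis using m by (simp add: sphere_L2_iff)
qed

text \<open>
The tight frame of rotation fields recovers the length of a tangential vector.
\<close>

lemma sum_rot_component:
  assumes "has_weak_sphere_grad u g"
  shows "(\<Sum>w\<in>Basis. ip (rot_component w g) (rot_component w g)) = (sphere_L2_norm g)\<^sup>2"
proof -
  have g: "g \<in> sphere_L2" and tang: "AE s in sphere2. g s \<bullet> s = 0"
    using assms by (auto simp: has_weak_sphere_grad_def)
  have L: "rot_component w g \<in> sphere_L2" if "w \<in> Basis" for w
    using that g by (intro rot_component_L2) auto
  have "(\<Sum>w\<in>Basis. ip (rot_component w g) (rot_component w g))
      = (LINT s|sphere2. (\<Sum>w\<in>Basis. (rot_component w g s)\<^sup>2))"
    unfolding ip_self using L
    by (intro Bochner_Integration.integral_sum[symmetric]) (auto simp: sphere_L2_iff)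
  also have "\<dots> = (LINT s|sphere2. (norm (g s))\<^sup>2)"
  proof (rule integral_cong_AE)
    show "(\<lambda>s. \<Sum>w\<in>Basis. (rot_component w g s)\<^sup>2) \<in> borel_measurable sphere2"
      using L by (intro borel_measurable_sum borel_measurable_power) (auto simp: sphere_L2_iff)
    show "(\<lambda>s. (norm (g s))\<^sup>2) \<in> borel_measurable sphere2"
      using g by (auto simp: sphere_L2_def)
    show "AE s in sphere2. (\<Sum>w\<in>Basis. (rot_component w g s)\<^sup>2) = (norm (g s))\<^sup>2"
      using tang AE_space
    proof eventually_elim
      case (elim s)
      have "(\<Sum>w\<in>Basis. (rot_component w g s)\<^sup>2)
          = (\<Sum>w\<in>Basis. (g s \<bullet> cross3 w s) *\<^sub>R cross3 w s) \<bullet> g s"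
        by (simp add: rot_component_def inner_sum_left power2_eq_square inner_commute[of "cross3 _ _" "g s"])
      also have "\<dots> = (s \<bullet> s) * (g s \<bullet> g s) - (g s \<bullet> s) * (s \<bullet> g s)"
        unfolding cross_Basis_expand by (simp add: inner_diff_left)
      also have "\<dots> = (norm (g s))\<^sup>2" using elim by (simp add: dot_square_norm)
      finally show ?case .
    qed
  qed
  also have "\<dots> = (sphere_L2_norm g)\<^sup>2" by (simp add: sphere_L2_norm_def)
  finally show ?thesis .
qed

text \<open>
The definition of the weak gradient, tested with a rotation field multiplied by \<open>f\<close>.
\<close>

lemma ip_rot_component:
  assumes u: "has_weak_sphere_grad u g" and f: "deg_less n f"
  shows "ip (rot_component w g) f = - ip u (rot w f)"
proof -
  have "(LINT s|sphere2. g s \<bullet> (f s *\<^sub>R cross3 w s))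
      = - (LINT s|sphere2. u s * sphere_div (\<lambda>x. f x *\<^sub>R cross3 w x) s)"
    using u rotation_field_smooth[OF f, of w] unfolding has_weak_sphere_grad_def by blast
  then show ?thesis
    by (simp add: sphere_div_rotation_field[OF f] ip_def rot_component_def mult.commute)
qed

lemma lap_sum_harmonic:
  assumes s: "s \<in> sphere 0 1"
  shows "lap (\<lambda>x. \<Sum>k<K. c k * harmonic k x) s = - (\<Sum>k<K. (eigenvalue (floor_sqrt k) * c k) * harmonic k s)"
proof -
  have d: "deg_less (Suc K) (harmonic k)" if "k < K" for k
    using deg_less_mono[OF deg_less_harmonic[of k], of "Suc K"] floor_sqrt_le[of k] that by simp
  have 1: "rot w (\<lambda>x. \<Sum>k<K. c k * harmonic k x) = (\<lambda>x. \<Sum>k<K. c k * rot w (harmonic k) x)" for w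
    using d by (subst rot_sum[of _ "Suc K"]) (auto simp: deg_less_scale rot_scale[of "Suc K"])
  have 2: "rot w (\<lambda>x. \<Sum>k<K. c k * rot w (harmonic k) x) = (\<lambda>x. \<Sum>k<K. c k * rot w (rot w (harmonic k)) x)" for w
    using d by (subst rot_sum[of _ "Suc K"]) (auto simp: deg_less_scale deg_less_rot rot_scale[of "Suc K"])
  have "lap (\<lambda>x. \<Sum>k<K. c k * harmonic k x) s = (\<Sum>k<K. c k * lap (harmonic k) s)"
    unfolding lap_def 1 2 sum_distrib_left by (rule sum.swap)
  then show ?thesis by (simp add: lap_harmonic[OF s] sum_negf algebra_simps)
qed

text \<open>
Bessel's inequality for gradients. Let \<open>f\<close> be the projection of \<open>u\<close> to the first \<open>K\<close> harmonics. Both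
\<open>\<langle>\<nabla>u, \<nabla>f\<rangle> = - \<langle>u, \<Delta>f\<rangle>\<close> and \<open>\<parallel>\<nabla>f\<parallel>\<^sup>2 = - \<langle>f, \<Delta>f\<rangle>\<close> equal the left side, so
\<open>0 \<le> \<parallel>\<nabla>u - \<nabla>f\<parallel>\<^sup>2\<close> is the claim. The gradients are represented by their components along
the rotation fields.
\<close>

lemma energy_bessel:
  assumes u: "u \<in> sphere_L2" and g: "has_weak_sphere_grad u g"
  shows "(\<Sum>k<K. eigenvalue (floor_sqrt k) * (ip u (harmonic k))\<^sup>2) \<le> (sphere_L2_norm g)\<^sup>2"
proof -
  define c where "c k = ip u (harmonic k)" for k
  define f where "f x = (\<Sum>k<K. c k * harmonic k x)" for x
  define S where "S = (\<Sum>k<K. eigenvalue (floor_sqrt k) * (c k)\<^sup>2)"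
  have f: "deg_less (Suc K) f"
    unfolding f_def[abs_def] using floor_sqrt_le
    by (intro deg_less_sum deg_less_scale deg_less_mono[OF deg_less_harmonic])
      (auto intro: le_trans less_imp_le)
  have o: "orthosystem {..<K} harmonic" by (rule orthosystem_harmonic) simp
  have lapf: "lap f s = (\<Sum>k<K. (- (eigenvalue (floor_sqrt k) * c k)) * harmonic k s)" if "s \<in> sphere 0 1" for s
    unfolding f_def[abs_def] lap_sum_harmonic[OF that] by (simp add: sum_negf)
  have "ip h (lap f) = ip h (\<lambda>s. \<Sum>k<K. (- (eigenvalue (floor_sqrt k) * c k)) * harmonic k s)" for h
    by (rule ip_cong) (auto simp: lapf)
  note lap_ip = this
  have lu: "ip u (lap f) = - S"
    unfolding lap_ip ip_orthosystem_right[OF o u] S_def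
    by (simp add: sum_negf power2_eq_square mult.assoc flip: c_def)
  have coef: "c k * (- (eigenvalue (floor_sqrt k) * c k)) * ip (harmonic k) (harmonic k)
      = - (eigenvalue (floor_sqrt k) * (c k)\<^sup>2)" for k
    using orthosystem_harmonic[of "{k}"] by (auto simp: orthosystem_def c_def power2_eq_square)
  have lf: "ip f (lap f) = - S"
    unfolding lap_ip unfolding f_def[abs_def] ip_orthosystem_self[OF o] S_def coef sum_negf ..
  have L: "rot_component w g \<in> sphere_L2" if "w \<in> Basis" for w
    using that g by (intro rot_component_L2) (auto simp: has_weak_sphere_grad_def)
  have "0 \<le> (\<Sum>w\<in>Basis. ip (\<lambda>s. rot_component w g s - rot w f s) (\<lambda>s. rot_component w g s - rot w f s))"
    by (intro sum_nonneg ip_nonneg)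
  also have "\<dots> = (\<Sum>w\<in>Basis. ip (rot_component w g) (rot_component w g)
      - 2 * ip (rot_component w g) (rot w f) + ip (rot w f) (rot w f))"
    by (intro sum.cong refl ip_diff_self L sphere_L2_deg_less[OF deg_less_rot[OF f]])
  also have "\<dots> = (sphere_L2_norm g)\<^sup>2 - 2 * (\<Sum>w\<in>Basis. ip (rot_component w g) (rot w f))
      + (\<Sum>w\<in>Basis. ip (rot w f) (rot w f))"
    by (simp add: sum.distrib sum_subtractf sum_distrib_left sum_rot_component[OF g])
  also have "(\<Sum>w\<in>Basis. ip (rot w f) (rot w f)) = S"
    using ip_rot_rot[OF f f] lf by simp
  also have "(\<Sum>w\<in>Basis. ip (rot_component w g) (rot w f)) = - ip u (lap f)"
    unfolding ip_rot_component[OF g deg_less_rot[OF f]] lap_def[abs_def] sum_negf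
    by (subst ip_sum_right) (auto intro: sphere_L2_deg_less[OF deg_less_rot[OF deg_less_rot[OF f]]] u)
  finally show ?thesis unfolding lu by (simp add: S_def c_def)
qed

text \<open>
The squared norm of \<open>u\<close> minus its projection to the harmonics of degree at most \<open>n\<close>.
\<close>

definition tail :: "(real^3 \<Rightarrow> real) \<Rightarrow> nat \<Rightarrow> real" where
  "tail u n = ip u u - (\<Sum>k<(Suc n)\<^sup>2. (ip u (harmonic k))\<^sup>2)"

lemma tail_antimono:
  assumes "m \<le> n" shows "tail u n \<le> tail u m"
proof -
  have "(Suc m)\<^sup>2 \<le> (Suc n)\<^sup>2" using assms by (intro power_mono) auto
  then show ?thesis unfolding tail_def by (intro diff_left_mono sum_mono2) auto
qed

text \<open>
If a polynomial \<open>p\<close> is close to \<open>u\<close>, so is the projection of \<open>u\<close> to the harmonics of a degree that covers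
\<open>p\<close>: subtracting \<open>p\<close>, which the projection reproduces, does not change the residual, and the residual
of \<open>u - p\<close> is no longer than \<open>u - p\<close>.
\<close>

lemma tail_eventually_less:
  assumes u: "u \<in> sphere_L2" and e: "e > 0"
  shows "\<exists>n. tail u n < e"
proof -
  obtain n p where p: "deg_less n p" "ip (\<lambda>s. u s - p s) (\<lambda>s. u s - p s) < e"
    using poly_approx_sphere_L2[OF u] e unfolding poly_approx_def by blast
  define h where "h s = u s - p s" for s
  \<comment> \<open>the tail of index \<open>n\<close> belongs to the polynomials of degree less than \<open>n + 1\<close>\<close>
  note p' = deg_less_Suc[OF p(1)]
  have h: "h \<in> sphere_L2" unfolding h_def[abs_def] by (intro sphere_L2_diff u sphere_L2_deg_less[OF p(1)])
  have o: "orthosystem {..<(Suc n)\<^sup>2} harmonic" by (rule orthosystem_harmonic) simp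
  have iph: "ip h (harmonic k) = ip u (harmonic k) - ip p (harmonic k)" for k
    unfolding h_def[abs_def] by (intro ip_diff_left u sphere_L2_deg_less[OF p(1)] harmonic_L2)
  have eq: "h s - (\<Sum>k<(Suc n)\<^sup>2. ip h (harmonic k) * harmonic k s)
      = u s - (\<Sum>k<(Suc n)\<^sup>2. ip u (harmonic k) * harmonic k s)" if "s \<in> sphere 0 1" for s
    using harmonic_reproducing[OF p' that]
    by (simp add: iph left_diff_distrib sum_subtractf) (simp add: h_def)
  have "tail u n = ip (\<lambda>s. u s - (\<Sum>k<(Suc n)\<^sup>2. ip u (harmonic k) * harmonic k s))
      (\<lambda>s. u s - (\<Sum>k<(Suc n)\<^sup>2. ip u (harmonic k) * harmonic k s))"
    unfolding tail_def by (rule orthosystem_residual[OF o u, symmetric])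
  also have "\<dots> = ip (\<lambda>s. h s - (\<Sum>k<(Suc n)\<^sup>2. ip h (harmonic k) * harmonic k s))
      (\<lambda>s. h s - (\<Sum>k<(Suc n)\<^sup>2. ip h (harmonic k) * harmonic k s))"
    by (rule ip_cong) (auto simp: eq)
  also have "\<dots> \<le> ip h h"
    unfolding orthosystem_residual[OF o h] by (simp add: sum_nonneg)
  also have "\<dots> < e" using p(2) unfolding h_def[abs_def] .
  finally show ?thesis ..
qed

lemma sum_eigenvalue_gaps: "(\<Sum>n<m. 2 * (real n + 1)) = eigenvalue m"
  by (induction m) (auto simp: eigenvalue_def algebra_simps)

text \<open>
Summation by parts. A coefficient of degree \<open>m\<close> occurs in the tails of index \<open>n < m\<close>, and the gaps
\<open>\<lambda>\<^bsub>n+1\<^esub> - \<lambda>\<^sub>n = 2 (n + 1)\<close> with \<open>n < m\<close> add up to \<open>\<lambda>\<^sub>m\<close>. To have finite sums, a tail of large index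
\<open>L\<close> is subtracted first; completeness makes its contribution smaller than any \<open>e > 0\<close>.
\<close>

lemma tail_sum_le:
  assumes u: "u \<in> sphere_L2" and g: "has_weak_sphere_grad u g"
  shows "(\<Sum>n<M. 2 * (real n + 1) * tail u n) \<le> (sphere_L2_norm g)\<^sup>2"
proof (rule field_le_epsilon)
  fix e :: real assume e: "e > 0"
  have ev: "0 \<le> eigenvalue M" by (simp add: eigenvalue_def)
  obtain m where m: "tail u m < e / (eigenvalue M + 1)"
    using tail_eventually_less[OF u, of "e / (eigenvalue M + 1)"] e ev by auto
  define L where "L = max m M"
  have L: "tail u L < e / (eigenvalue M + 1)"
    using m tail_antimono[of m L u] by (simp add: L_def)
  define c where "c k = (ip u (harmonic k))\<^sup>2" for k
  have gap: "tail u n - tail u L = (\<Sum>k<(Suc L)\<^sup>2. if n < floor_sqrt k then c k else 0)" if "n < M" for n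
  proof -
    have sub: "(Suc n)\<^sup>2 \<le> (Suc L)\<^sup>2" using that by (intro power_mono) (auto simp: L_def)
    have "tail u n - tail u L = sum c {..<(Suc L)\<^sup>2} - sum c {..<(Suc n)\<^sup>2}"
      by (simp add: tail_def c_def)
    also have "\<dots> = sum c {(Suc n)\<^sup>2..<(Suc L)\<^sup>2}"
      using sum.atLeastLessThan_concat[of 0 "(Suc n)\<^sup>2" "(Suc L)\<^sup>2" c] sub by (simp add: lessThan_atLeast0)
    also have "\<dots> = (\<Sum>k<(Suc L)\<^sup>2. if n < floor_sqrt k then c k else 0)"
      by (intro sum.mono_neutral_cong_left) (auto simp: Suc_le_eq simp flip: le_floor_sqrt_iff)
    finally show ?thesis .
  qed
  have "(\<Sum>n<M. 2 * (real n + 1) * tail u n)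
      = (\<Sum>n<M. 2 * (real n + 1) * (tail u n - tail u L)) + eigenvalue M * tail u L"
    unfolding sum_eigenvalue_gaps[symmetric] sum_distrib_right sum.distrib[symmetric]
    by (simp add: algebra_simps)
  also have "(\<Sum>n<M. 2 * (real n + 1) * (tail u n - tail u L))
      = (\<Sum>n<M. \<Sum>k<(Suc L)\<^sup>2. if n < floor_sqrt k then 2 * (real n + 1) * c k else 0)"
    by (intro sum.cong) (auto simp: gap sum_distrib_left intro!: sum.cong)
  also have "\<dots> = (\<Sum>k<(Suc L)\<^sup>2. \<Sum>n<M. if n < floor_sqrt k then 2 * (real n + 1) * c k else 0)"
    by (rule sum.swap)
  also have "\<dots> \<le> (\<Sum>k<(Suc L)\<^sup>2. eigenvalue (floor_sqrt k) * c k)"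
  proof (rule sum_mono)
    fix k
    have "(\<Sum>n<M. if n < floor_sqrt k then 2 * (real n + 1) * c k else 0)
        = (\<Sum>n\<in>{..<M} \<inter> {..<floor_sqrt k}. 2 * (real n + 1) * c k)"
      by (simp only: sum.inter_restrict finite_lessThan lessThan_iff)
    also have "\<dots> \<le> (\<Sum>n<floor_sqrt k. 2 * (real n + 1) * c k)"
      by (intro sum_mono2) (auto simp: c_def)
    also have "\<dots> = eigenvalue (floor_sqrt k) * c k"
      unfolding sum_distrib_right[symmetric] sum_eigenvalue_gaps ..
    finally show "(\<Sum>n<M. if n < floor_sqrt k then 2 * (real n + 1) * c k else 0) \<le> eigenvalue (floor_sqrt k) * c k" .
  qed
  also have "\<dots> \<le> (sphere_L2_norm g)\<^sup>2" unfolding c_def by (rule energy_bessel[OF u g])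
  also have "eigenvalue M * tail u L \<le> eigenvalue M * (e / (eigenvalue M + 1))"
    using L ev by (intro mult_left_mono) auto
  also have "\<dots> \<le> e" using e ev by (simp add: field_simps)
  finally show "(\<Sum>n<M. 2 * (real n + 1) * tail u n) \<le> (sphere_L2_norm g)\<^sup>2 + e" by simp
qed

section \<open>A Riemann sum for the integral over energies\<close>

text \<open>
The integral of \<open>2 t (r - t)\<^sup>2\<close> over \<open>0 \<le> t \<le> min u r\<close>. With \<open>t\<^sup>2 = c E\<close> it is \<open>c\<close> times the
integral of \<open>(r - \<surd>(c E))\<^sub>+\<^sup>2\<close> over the energies \<open>E\<close> up to \<open>u\<^sup>2 / c\<close>.
\<close>

definition layer :: "real \<Rightarrow> real \<Rightarrow> real" where
  "layer r u = r\<^sup>2 * (min u r)\<^sup>2 - 4/3 * r * (min u r) ^ 3 + (min u r) ^ 4 / 2"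

text \<open>
The integral of the decreasing function \<open>(r - t)\<^sub>+\<^sup>2\<close> against \<open>2 t dt\<close> is at most the value at the left
end times the weight of the interval.
\<close>

lemma layer_step:
  assumes "0 \<le> u" "u \<le> v" "0 \<le> r"
  shows "layer r v - layer r u \<le> (v\<^sup>2 - u\<^sup>2) * (max 0 (r - u))\<^sup>2"
proof (cases "u \<ge> r")
  case True
  then show ?thesis using assms by (simp add: layer_def)
next
  case False
  \<comment> \<open>in terms of \<open>u\<close>, \<open>d\<close> and \<open>e\<close> the difference of the two sides has nonnegative coefficients\<close>
  define d where "d = min v r - u"
  define e where "e = r - min v r"
  have de: "0 \<le> d" "0 \<le> e" using False assms by (auto simp: d_def e_def)
  have r: "r = u + d + e" and mv: "min v r = u + d" and mu: "min u r = u" and mx: "max 0 (r - u) = d + e"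
    using False by (auto simp: d_def e_def)
  have "((u + d)\<^sup>2 - u\<^sup>2) * (d + e)\<^sup>2 - (layer r v - layer r u)
      = 2 * u * (2/3 * d ^ 3 + e * d\<^sup>2) + (5/6 * d ^ 4 + 4/3 * e * d ^ 3)"
    unfolding layer_def mv mu unfolding r by (simp add: field_simps eval_nat_numeral)
  also have "\<dots> \<ge> 0" using de assms by simp
  finally have "layer r v - layer r u \<le> ((u + d)\<^sup>2 - u\<^sup>2) * (d + e)\<^sup>2" by simp
  also have "\<dots> \<le> (v\<^sup>2 - u\<^sup>2) * (d + e)\<^sup>2"
  proof (intro mult_right_mono diff_right_mono power_mono)
    show "u + d \<le> v" using mv by linarith
    show "0 \<le> u + d" using assms de by linarith
  qed simp
  finally show ?thesis unfolding mx .
qed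

text \<open>
Once \<open>u M\<close> exceeds \<open>r\<close>, the integral has its full value \<open>r\<^sup>4 (1 - 4/3 + 1/2) = r\<^sup>4 / 6\<close>.
\<close>

lemma layer_sum_ge:
  fixes u :: "nat \<Rightarrow> real" and r :: real
  assumes mono: "\<And>n. u n \<le> u (Suc n)" and 0: "u 0 = 0" and r: "0 \<le> r" and M: "r \<le> u M"
  shows "r ^ 4 / 6 \<le> (\<Sum>n<M. ((u (Suc n))\<^sup>2 - (u n)\<^sup>2) * (max 0 (r - u n))\<^sup>2)"
proof -
  have nn: "0 \<le> u n" for n
  proof (induction n)
    case (Suc n)
    then show ?case using mono[of n] by linarith
  qed (simp add: 0)
  have "r ^ 4 / 6 = layer r (u M) - layer r (u 0)"
    using M r by (simp add: layer_def 0 eval_nat_numeral)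
  also have "\<dots> = (\<Sum>n<M. layer r (u (Suc n)) - layer r (u n))"
    by (rule sum_lessThan_telescope[symmetric])
  also have "\<dots> \<le> (\<Sum>n<M. ((u (Suc n))\<^sup>2 - (u n)\<^sup>2) * (max 0 (r - u n))\<^sup>2)"
    by (intro sum_mono layer_step nn mono r)
  finally show ?thesis .
qed

section \<open>Low and high frequencies at a point\<close>

definition residual :: "(real^3 \<Rightarrow> real) \<Rightarrow> nat \<Rightarrow> real^3 \<Rightarrow> real" where
  "residual u n s = u s - (\<Sum>k<(Suc n)\<^sup>2. ip u (harmonic k) * harmonic k s)"

lemma residual_L2: "u \<in> sphere_L2 \<Longrightarrow> residual u n \<in> sphere_L2"
  unfolding residual_def[abs_def] by (intro sphere_L2_diff sphere_L2_sum sphere_L2_scale harmonic_L2)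

lemma ip_residual: "u \<in> sphere_L2 \<Longrightarrow> ip (residual u n) (residual u n) = tail u n"
  unfolding residual_def[abs_def] tail_def
  by (intro orthosystem_residual orthosystem_harmonic) auto

text \<open>
The low parts at \<open>s\<close> are the inner products of the \<open>\<psi> j\<close> with \<open>h\<close>, the kernel at \<open>s\<close> without its constant
term. That term may be omitted because the averages of the \<open>\<psi> j\<close> vanish, and without it the bound is
\<open>0\<close> for \<open>n = 0\<close>.
\<close>

lemma low_frequency_le:
  assumes psi: "orthosystem J \<psi>" and avg: "\<And>j. j \<in> J \<Longrightarrow> (LINT s|sphere2. \<psi> j s) = 0"
    and s: "s \<in> sphere 0 1"
  shows "(\<Sum>j\<in>J. (\<psi> j s - residual (\<psi> j) n s)\<^sup>2) \<le> ((real n + 1)\<^sup>2 - 1) / (4 * pi)"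
proof -
  define I where "I = {1..<(Suc n)\<^sup>2}"
  define h where "h x = (\<Sum>k\<in>I. harmonic k s * harmonic k x)" for x
  have o: "orthosystem I harmonic" by (rule orthosystem_harmonic) (simp add: I_def)
  have h: "h \<in> sphere_L2" unfolding h_def[abs_def] by (rule orthosystem_L2[OF o])
  have "\<psi> j s - residual (\<psi> j) n s = ip h (\<psi> j)" if j: "j \<in> J" for j
  proof -
    have L: "\<psi> j \<in> sphere_L2" using psi j by (simp add: orthosystem_def)
    obtain c where c: "harmonic 0 = (\<lambda>x. c)" using harmonic_0_const by blast
    have 0: "ip (\<psi> j) (harmonic 0) = 0" by (simp add: ip_def c avg[OF j])
    have "\<psi> j s - residual (\<psi> j) n s = (\<Sum>k<(Suc n)\<^sup>2. ip (\<psi> j) (harmonic k) * harmonic k s)"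
      by (simp add: residual_def)
    also have "\<dots> = (\<Sum>k\<in>I. ip (\<psi> j) (harmonic k) * harmonic k s)"
    proof (intro sum.mono_neutral_right ballI)
      fix k assume "k \<in> {..<(Suc n)\<^sup>2} - I"
      then have "k = 0" by (auto simp: I_def)
      then show "ip (\<psi> j) (harmonic k) * harmonic k s = 0" by (simp add: 0)
    qed (auto simp: I_def)
    also have "\<dots> = ip (\<psi> j) h"
      unfolding h_def[abs_def] ip_orthosystem_right[OF o L] by (simp add: mult.commute)
    finally show ?thesis by (simp add: ip_commute)
  qed
  then have "(\<Sum>j\<in>J. (\<psi> j s - residual (\<psi> j) n s)\<^sup>2) = (\<Sum>j\<in>J. (ip h (\<psi> j))\<^sup>2)" by simp
  also have "\<dots> \<le> ip h h" by (rule orthosystem_bessel[OF psi h])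
  also have "\<dots> = (\<Sum>k\<in>I. (harmonic k s)\<^sup>2)"
    unfolding h_def[abs_def] ip_orthosystem_self[OF o]
    by (intro sum.cong refl harmonic_square)
  also have "\<dots> \<le> ((real n + 1)\<^sup>2 - 1) / (4 * pi)" unfolding I_def by (rule kernel_diagonal_le[OF s])
  finally show ?thesis .
qed

text \<open>
The constant \<open>3 / 8\<pi>\<close> is the least one with \<open>((n + 1)\<^sup>2 - 1) / 4\<pi> \<le> (threshold n)\<^sup>2\<close> for every \<open>n\<close>;
equality holds for \<open>n = 0\<close> and \<open>n = 1\<close>.
\<close>

definition threshold :: "nat \<Rightarrow> real" where
  "threshold n = sqrt (3 / (8 * pi) * eigenvalue n)"

lemma eigenvalue_nonneg: "0 \<le> eigenvalue n"
  by (simp add: eigenvalue_def)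

lemma threshold_power2: "(threshold n)\<^sup>2 = 3 / (8 * pi) * eigenvalue n"
  by (simp add: threshold_def eigenvalue_nonneg)

lemma threshold_mono: "threshold n \<le> threshold (Suc n)"
  unfolding threshold_def eigenvalue_def
  by (intro real_sqrt_le_mono mult_left_mono mult_mono) auto

lemma counting_le_threshold: "((real n + 1)\<^sup>2 - 1) / (4 * pi) \<le> (threshold n)\<^sup>2"
proof -
  have "2 * (real n * (real n + 2)) \<le> 3 * (real n * (real n + 1))"
    by (cases n) (auto simp: algebra_simps)
  then show ?thesis
    unfolding threshold_power2 eigenvalue_def by (simp add: field_simps power2_eq_square)
qed

lemma threshold_unbounded: "\<exists>M. r \<le> threshold M"
proof -
  obtain M :: nat where M: "r\<^sup>2 * (8 * pi / 3) \<le> real M" using real_arch_simple by blast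
  have "real M * 1 \<le> real M * (real M + 1)" by (intro mult_left_mono) auto
  then have "r\<^sup>2 * (8 * pi / 3) \<le> eigenvalue M" using M by (simp add: eigenvalue_def)
  then have "r\<^sup>2 \<le> (threshold M)\<^sup>2" unfolding threshold_power2 by (simp add: field_simps)
  then have "r \<le> threshold M"
    by (rule power2_le_imp_le) (simp add: threshold_def eigenvalue_nonneg)
  then show ?thesis ..
qed

text \<open>
Triangle inequality in \<open>\<real>\<^sup>J\<close> for the splitting of the vector of values \<open>\<psi> j s\<close> into low part and
residual.
\<close>

lemma high_frequency_ge:
  assumes psi: "orthosystem J \<psi>" and avg: "\<And>j. j \<in> J \<Longrightarrow> (LINT s|sphere2. \<psi> j s) = 0"
    and s: "s \<in> sphere 0 1"
  shows "(max 0 (sqrt (\<Sum>j\<in>J. (\<psi> j s)\<^sup>2) - threshold n))\<^sup>2 \<le> (\<Sum>j\<in>J. (residual (\<psi> j) n s)\<^sup>2)"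
proof -
  let ?R = "\<Sum>j\<in>J. (residual (\<psi> j) n s)\<^sup>2"
  have R: "0 \<le> ?R" by (simp add: sum_nonneg)
  have "sqrt (\<Sum>j\<in>J. (\<psi> j s - residual (\<psi> j) n s)\<^sup>2) \<le> sqrt ((threshold n)\<^sup>2)"
    using low_frequency_le[OF assms, of n] counting_le_threshold[of n] by (intro real_sqrt_le_mono) linarith
  then have low: "sqrt (\<Sum>j\<in>J. (\<psi> j s - residual (\<psi> j) n s)\<^sup>2) \<le> threshold n"
    by (simp add: threshold_def eigenvalue_nonneg)
  have "sqrt (\<Sum>j\<in>J. (\<psi> j s)\<^sup>2) \<le> sqrt ?R + sqrt (\<Sum>j\<in>J. (\<psi> j s - residual (\<psi> j) n s)\<^sup>2)"
    using L2_set_triangle_ineq[of "\<lambda>j. residual (\<psi> j) n s" "\<lambda>j. \<psi> j s - residual (\<psi> j) n s" J]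
    by (simp add: L2_set_def)
  then have "max 0 (sqrt (\<Sum>j\<in>J. (\<psi> j s)\<^sup>2) - threshold n) \<le> sqrt ?R" using low R by simp
  then have "(max 0 (sqrt (\<Sum>j\<in>J. (\<psi> j s)\<^sup>2) - threshold n))\<^sup>2 \<le> (sqrt ?R)\<^sup>2"
    by (intro power_mono) auto
  then show ?thesis using R by simp
qed

section \<open>The Lieb-Thirring inequality\<close>

text \<open>
The weighted sums \<open>B M\<close> of the squared residuals of index \<open>n < M\<close> increase with \<open>M\<close> and have integrals
bounded by the energy. At each point some \<open>B M\<close> is at least \<open>\<rho>\<^sup>2\<close>, where \<open>\<rho>\<close> is the sum of the
squares of the \<open>\<psi> j\<close>, but \<open>M\<close> depends on the point since
\<open>\<rho>\<close> may be unbounded; monotone convergence passes to the supremum. The statement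
for the nonnegative integral contains the integrability of \<open>\<rho>\<^sup>2\<close>.
\<close>

lemma lieb_thirring_sphere_nn:
  assumes psi: "orthosystem J \<psi>" and avg: "\<And>j. j \<in> J \<Longrightarrow> (LINT s|sphere2. \<psi> j s) = 0"
    and g: "\<And>j. j \<in> J \<Longrightarrow> has_weak_sphere_grad (\<psi> j) (g j)"
  shows "(\<integral>\<^sup>+s. ennreal ((\<Sum>j\<in>J. (\<psi> j s)\<^sup>2)\<^sup>2) \<partial>sphere2)
    \<le> ennreal (9 / (4 * pi) * (\<Sum>j\<in>J. (sphere_L2_norm (g j))\<^sup>2))"
proof -
  define c :: real where "c = 3 / (8 * pi)"
  have c: "c > 0" by (simp add: c_def)
  have L: "\<psi> j \<in> sphere_L2" if "j \<in> J" for j using psi that by (simp add: orthosystem_def)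
  have res: "integrable sphere2 (\<lambda>s. (residual (\<psi> j) n s)\<^sup>2)" if "j \<in> J" for j n
    using residual_L2[OF L[OF that]] by (simp add: sphere_L2_iff)
  define B where "B M s = 6 * (\<Sum>n<M. c * (2 * (real n + 1)) * (\<Sum>j\<in>J. (residual (\<psi> j) n s)\<^sup>2))" for M s
  have B_int: "integrable sphere2 (B M)" for M
    unfolding B_def[abs_def]
    by (intro integrable_mult_right Bochner_Integration.integrable_sum) (auto intro: res)
  have B_nonneg: "0 \<le> B M s" for M s
    unfolding B_def using c by (intro mult_nonneg_nonneg sum_nonneg) auto
  have B_mono: "incseq (\<lambda>M s. ennreal (B M s))"
  proof (intro incseq_SucI le_funI ennreal_leI)
    fix M s
    have "0 \<le> c * (2 * (real M + 1)) * (\<Sum>j\<in>J. (residual (\<psi> j) M s)\<^sup>2)"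
      using c by (intro mult_nonneg_nonneg sum_nonneg) auto
    then show "B M s \<le> B (Suc M) s" by (simp add: B_def)
  qed
  have B_integral: "integral\<^sup>L sphere2 (B M) \<le> 9 / (4 * pi) * (\<Sum>j\<in>J. (sphere_L2_norm (g j))\<^sup>2)" for M
  proof -
    have "integral\<^sup>L sphere2 (B M)
        = 6 * (\<Sum>n<M. c * (2 * (real n + 1)) * (\<Sum>j\<in>J. LINT s|sphere2. (residual (\<psi> j) n s)\<^sup>2))"
      unfolding B_def[abs_def] using res
      by (simp add: Bochner_Integration.integral_sum Bochner_Integration.integrable_sum)
    also have "\<dots> = 6 * (\<Sum>n<M. c * (2 * (real n + 1)) * (\<Sum>j\<in>J. tail (\<psi> j) n))"
      by (simp add: ip_residual[OF L] flip: ip_self)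
    also have "\<dots> = 6 * c * (\<Sum>j\<in>J. \<Sum>n<M. 2 * (real n + 1) * tail (\<psi> j) n)"
      unfolding sum_distrib_left by (subst sum.swap) (simp add: mult.assoc)
    also have "\<dots> \<le> 6 * c * (\<Sum>j\<in>J. (sphere_L2_norm (g j))\<^sup>2)"
      using c by (intro mult_left_mono sum_mono tail_sum_le L g) auto
    also have "6 * c = 9 / (4 * pi)" by (simp add: c_def)
    finally show ?thesis .
  qed
  have pointwise: "\<exists>M. (\<Sum>j\<in>J. (\<psi> j s)\<^sup>2)\<^sup>2 \<le> B M s" if s: "s \<in> sphere 0 1" for s
  proof -
    define r where "r = sqrt (\<Sum>j\<in>J. (\<psi> j s)\<^sup>2)"
    have nn: "0 \<le> (\<Sum>j\<in>J. (\<psi> j s)\<^sup>2)" by (simp add: sum_nonneg)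
    then have r: "0 \<le> r" "r\<^sup>2 = (\<Sum>j\<in>J. (\<psi> j s)\<^sup>2)" by (auto simp: r_def)
    obtain M where M: "r \<le> threshold M" using threshold_unbounded by blast
    have gap: "(threshold (Suc n))\<^sup>2 - (threshold n)\<^sup>2 = c * (2 * (real n + 1))" for n
      unfolding threshold_power2 c_def[symmetric] eigenvalue_def by (simp add: algebra_simps)
    have "r ^ 4 / 6 \<le> (\<Sum>n<M. ((threshold (Suc n))\<^sup>2 - (threshold n)\<^sup>2) * (max 0 (r - threshold n))\<^sup>2)"
      by (intro layer_sum_ge threshold_mono r M) (simp add: threshold_def eigenvalue_def)
    also have "\<dots> \<le> (\<Sum>n<M. c * (2 * (real n + 1)) * (\<Sum>j\<in>J. (residual (\<psi> j) n s)\<^sup>2))"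
      unfolding gap r_def using c
      by (intro sum_mono mult_left_mono high_frequency_ge[OF psi avg s]) auto
    finally have "(r\<^sup>2)\<^sup>2 \<le> B M s" by (simp add: B_def)
    then show ?thesis unfolding r by blast
  qed
  have "(\<integral>\<^sup>+s. ennreal ((\<Sum>j\<in>J. (\<psi> j s)\<^sup>2)\<^sup>2) \<partial>sphere2) \<le> (\<integral>\<^sup>+s. (SUP M. ennreal (B M s)) \<partial>sphere2)"
  proof (rule nn_integral_mono)
    fix s assume "s \<in> space sphere2"
    then obtain M where "(\<Sum>j\<in>J. (\<psi> j s)\<^sup>2)\<^sup>2 \<le> B M s" using pointwise by auto
    then show "ennreal ((\<Sum>j\<in>J. (\<psi> j s)\<^sup>2)\<^sup>2) \<le> (SUP M. ennreal (B M s))"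
      by (intro SUP_upper2[of M]) (auto intro: ennreal_leI)
  qed
  also have "\<dots> = (SUP M. \<integral>\<^sup>+s. ennreal (B M s) \<partial>sphere2)"
    using borel_measurable_integrable[OF B_int] by (intro nn_integral_monotone_convergence_SUP B_mono) simp
  also have "\<dots> \<le> ennreal (9 / (4 * pi) * (\<Sum>j\<in>J. (sphere_L2_norm (g j))\<^sup>2))"
    unfolding nn_integral_eq_integral[OF B_int AE_I2[OF B_nonneg]]
    by (intro SUP_least ennreal_leI B_integral)
  finally show ?thesis .
qed

theorem theorem2p1:
  fixes N :: nat and \<psi> :: "nat \<Rightarrow> real^3 \<Rightarrow> real" and \<rho> :: "real^3 \<Rightarrow> real"
  assumes "N \<ge> 1"
    and H1: "\<forall>j\<in>{1..N}. \<psi> j \<in> sphere_H1"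
    and orthonormal: "\<forall>i\<in>{1..N}. \<forall>j\<in>{1..N}.
          (LINT s|sphere2. \<psi> i s * \<psi> j s) = (if i = j then 1 else 0)"
    and zero_average: "\<forall>j\<in>{1..N}. (LINT s|sphere2. \<psi> j s) = 0"
    and rho: "\<forall>s\<in>sphere 0 1. \<rho> s = (\<Sum>j=1..N. (\<psi> j s)\<^sup>2)"
  shows "integrable sphere2 (\<lambda>s. (\<rho> s)\<^sup>2) \<and>
    (LINT s|sphere2. (\<rho> s)\<^sup>2) \<le> 9 / (4 * pi) * (\<Sum>j=1..N. (sphere_L2_norm (sphere_grad (\<psi> j)))\<^sup>2)"
proof -
  let ?G = "9 / (4 * pi) * (\<Sum>j=1..N. (sphere_L2_norm (sphere_grad (\<psi> j)))\<^sup>2)"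
  have G: "0 \<le> ?G" by (intro mult_nonneg_nonneg sum_nonneg) auto
  have psi: "orthosystem {1..N} \<psi>"
    using H1 orthonormal by (auto simp: orthosystem_def ip_def sphere_H1_def)
  have grad: "has_weak_sphere_grad (\<psi> j) (sphere_grad (\<psi> j))" if "j \<in> {1..N}" for j
  proof -
    have "\<exists>g. has_weak_sphere_grad (\<psi> j) g" using H1 that by (auto simp: sphere_H1_def)
    then show ?thesis unfolding sphere_grad_def by (rule someI_ex)
  qed
  have "(\<lambda>s. (\<Sum>j=1..N. (\<psi> j s)\<^sup>2)\<^sup>2) \<in> borel_measurable sphere2"
    using H1 by (intro borel_measurable_power borel_measurable_sum) (auto simp: sphere_H1_def sphere_L2_iff)
  then have m: "(\<lambda>s. (\<rho> s)\<^sup>2) \<in> borel_measurable sphere2"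
    by (rule measurable_cong[THEN iffD1, rotated]) (simp add: rho)
  have "(\<integral>\<^sup>+s. ennreal ((\<rho> s)\<^sup>2) \<partial>sphere2) = (\<integral>\<^sup>+s. ennreal ((\<Sum>j=1..N. (\<psi> j s)\<^sup>2)\<^sup>2) \<partial>sphere2)"
    by (intro nn_integral_cong) (simp add: rho)
  also have "\<dots> \<le> ennreal ?G"
    using zero_average grad by (intro lieb_thirring_sphere_nn psi) auto
  finally have le: "(\<integral>\<^sup>+s. ennreal ((\<rho> s)\<^sup>2) \<partial>sphere2) \<le> ennreal ?G" .
  have int: "integrable sphere2 (\<lambda>s. (\<rho> s)\<^sup>2)"
    using le by (intro integrableI_bounded m) (auto simp: le_less_trans[OF _ ennreal_less_top])
  have "ennreal (LINT s|sphere2. (\<rho> s)\<^sup>2) \<le> ennreal ?G"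
    using le by (simp add: nn_integral_eq_integral[OF int])
  then show ?thesis using int G by (simp add: ennreal_le_iff)
qed

end
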